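(* Let $M\ge 0$ be an integer, let $\vec\omega=\langle\omega_0,\dots,\omega_M\rangle$ be a vector of $M+1$ distinct complex numbers with $\omega_i-\omega_j\notin\mathbb Z$ for all $i\neq j$, let $\vec\rho=\langle\rho_0,\dots,\rho_M\rangle$ be a vector of $M+1$ nonnegative integers, and let $0\le m\le M$. Put $\sigma=\sum_{k=0}^M(\rho_k+1)$ and $\vec\rho\,!=\prod_{k=0}^M\rho_k!$. Then the Padé approximant $\mathrm{Poly}_m(z\mid\vec\omega;\vec\rho)$ is given by each of the following five expressions. (i) For $z\in\mathbb C\setminus[1,\infty)$, $$\frac{(-1)^{\sigma-1}}{2\pi i}\int_{\gamma_m}(1-z)^{\xi-\omega_m}\prod_{k=0}^M\frac1{(\xi-\omega_k)^{\underline{\rho_k+1}}}\,d\xi,$$ where $\gamma_m$ is a simple positively oriented contour enclosing all $\rho_m+1$ of the complex numbers $\omega_m+r$ ($0\le r\le\rho_m$) and none of the numbers $\omega_k+r$ ($0\le k\le M$, $k\ne m$, $0\le r\le\rho_k$). (ii) $$\frac1{\rho_m!}\sum_{r=0}^{\rho_m}(z-1)^r\binom{\rho_m}{r}\prod_{\substack{k=0\\k\ne m}}^M\frac1{(\omega_k-\omega_m-r)^{\overline{\rho_k+1}}}.$$ (iii) For $M\ge1$, the $M$-fold iterated integral $$\frac{Q_m}{\vec\rho\,!}\int_{(G)}T_m^{-\omega_m-1}\Bigg(\prod_{\substack{k=0\\k\ne m}}^M t_k^{\omega_k}(1+t_k)^{\rho_k}\Bigg)\left(1-(-1)^M\frac{1-z}{T_m}\right)^{\rho_m}d\vec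 t,$$ where $\int_{(G)}\cdots d\vec t$ integrates each of $t_0,\dots,t_M$ (except $t_m$) counterclockwise on the unit circle from $-\pi$ radians to $\pi$ radians (principal value), and $$Q_m=\prod_{\substack{k=0\\k\ne m}}^M\frac1{2i\sin(\pi(\omega_k-\omega_m))},\qquad T_m=\prod_{\substack{k=0\\k\ne m}}^M t_k.$$ (iv) $$\frac1{\rho_m!}\Bigg(\prod_{\substack{k=0\\k\ne m}}^M\frac1{(\omega_k-\omega_m)^{\overline{\rho_k+1}}}\Bigg)\;{}_{M+1}F_M\left[{\omega_m-\vec\omega-\vec\rho\atop(1+\omega_m-\vec\omega)^{\star m}}\,;\,1-z\right].$$ (v) $$\frac1{\vec\rho\,!}\sum_{r=0}^{\rho_m}(z-1)^r\prod_{k=0}^M C_{m,k,r},$$ where, with $W=W(m,k)=\omega_k-\omega_m$, $$C_{m,k,r}=\binom{\rho_k}{r}\quad\text{if }m=k,$$ $$C_{m,k,r}=(-1)^{\rho_k+1}\binom{r}{\rho_k}^{-1}\frac{\Gamma(r+1)}{\Gamma(r+1-W)}\,\frac{\Gamma(r-\rho_k-W)}{\Gamma(r-\rho_k+1)}\quad\text{if }m\ne k\text{ and }\rho_k<r,$$ $$C_{m,k,r}=(-1)^r\binom{\rho_k}{r}\frac{\Gamma(r+1)}{\Gamma(r+1-W)}\,\frac{\Gamma(\rho_k-r+1)}{\Gamma(\rho_k-r+1+W)}\,\frac{\pi}{\sin(\pi W)}\quad\text{if }m\ne k\text{ and }\rho_k\ge r.$$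
   Context: Vectors are indexed by $0,\dots,M$; adding a scalar to a vector means adding it to each coordinate; the exponent $\star m$ deletes the $m$-th coordinate of a vector. For complex $\omega$, $(1-z)^\omega$ denotes the principal branch on $\mathbb C\setminus[1,\infty)$ (equal to $1$ at $z=0$). Falling and rising factorials: $x^{\underline r}=x(x-1)\cdots(x-r+1)$ and $x^{\overline r}=x(x+1)\cdots(x+r-1)$ for positive integers $r$, and $x^{\underline 0}=x^{\overline 0}=1$. Padé approximants and remainder: there are unique polynomials $H_0,\dots,H_M$ with $\deg H_m\le\rho_m$ such that $G(z)=\sum_{m=0}^M H_m(z)(1-z)^{\omega_m}$ has a zero of order $\sigma-1$ at $z=0$ and $\lim_{z\to0}G(z)/z^{\sigma-1}=1/(\sigma-1)!$ (in fact $\deg H_m=\rho_m$). One writes $\mathrm{Poly}_m(z\mid\vec\omega;\vec\rho):=H_m(z)$ (the Padé approximants) and $\mathrm{Rem}(z\mid\vec\omega;\vec\rho):=G(z)$ (the Padé remainder). In (iii), for $t_k=e^{i\theta_k}$ with $-\pi<\theta_k<\pi$, powers are $t_k^{\omega}=e^{i\omega\theta_k}$, and the power of the product is $T_m^{-\omega_m-1}=\prod_{k\ne m}t_k^{-\omega_m-1}$. The generalized hypergeometric function is $${}_pF_q\left[{a_1,\dots,a_p\atop b_1,\dots,b_q};x\right]=\sum_{n=0}^\infty\frac{a_1^{\overline n}\cdots a_p^{\overline n}}{b_1^{\overline n}\cdots b_q^{\overline n}}\,\frac{x^n}{n!}.$$ In (iv) one upper parameter is $-\rho_m$, so the series terminates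 and is a polynomial in $1-z$. *)

theory Defs
  imports "HOL-Complex_Analysis.Complex_Analysis"
begin

text \<open>
  Vectors indexed by \<open>0, \<dots>, M\<close> are functions on \<^typ>\<open>nat\<close> of which only the values at
  arguments \<open>\<le> M\<close> are used.  The power \<open>(1 - z)\<^sup>w\<close> is \<^term>\<open>(1 - z) powr w\<close>, which is the
  principal branch off \<open>[1, \<infinity>)\<close>; the rising factorial is \<^const>\<open>pochhammer\<close>.
\<close>

definition falling_factorial :: "complex \<Rightarrow> nat \<Rightarrow> complex" where
  "falling_factorial x r = (\<Prod>i<r. x - of_nat i)"

definition pade_sigma :: "nat \<Rightarrow> (nat \<Rightarrow> nat) \<Rightarrow> nat" where
  "pade_sigma M \<rho> = (\<Sum>k\<le>M. \<rho> k + 1)"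

definition pade_form :: "nat \<Rightarrow> (nat \<Rightarrow> complex) \<Rightarrow> (nat \<Rightarrow> complex poly) \<Rightarrow> complex \<Rightarrow> complex" where
  "pade_form M \<omega> H z = (\<Sum>k\<le>M. poly (H k) z * (1 - z) powr \<omega> k)"

text \<open>The condition on indices above \<open>M\<close> only serves to make the family unique as a function.\<close>

definition is_pade_system ::
    "nat \<Rightarrow> (nat \<Rightarrow> complex) \<Rightarrow> (nat \<Rightarrow> nat) \<Rightarrow> (nat \<Rightarrow> complex poly) \<Rightarrow> bool" where
  "is_pade_system M \<omega> \<rho> H \<longleftrightarrow>
     (\<forall>k\<le>M. degree (H k) \<le> \<rho> k) \<and> (\<forall>k>M. H k = 0) \<and>
     zorder (pade_form M \<omega> H) 0 = int (pade_sigma M \<rho> - 1) \<and>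
     ((\<lambda>z. pade_form M \<omega> H z / z ^ (pade_sigma M \<rho> - 1))
        \<longlongrightarrow> 1 / fact (pade_sigma M \<rho> - 1)) (at 0)"

definition pade_poly :: "nat \<Rightarrow> (nat \<Rightarrow> complex) \<Rightarrow> (nat \<Rightarrow> nat) \<Rightarrow> nat \<Rightarrow> complex poly" where
  "pade_poly M \<omega> \<rho> m = (THE H. is_pade_system M \<omega> \<rho> H) m"

definition simple_positive_contour :: "(real \<Rightarrow> complex) \<Rightarrow> bool" where
  "simple_positive_contour \<gamma> \<longleftrightarrow>
     valid_path \<gamma> \<and> simple_path \<gamma> \<and> pathfinish \<gamma> = pathstart \<gamma> \<and>
     (\<forall>w\<in>inside (path_image \<gamma>). winding_number \<gamma> w = 1)"

text \<open>
  Iterated integral over the variables \<open>t k\<close> with \<open>k\<close> in the list (head outermost), each running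
  over the unit circle from angle \<open>-\<pi>\<close> to \<open>\<pi>\<close>.  On this path \<^term>\<open>t powr w\<close> is
  \<open>exp (\<i> w \<theta>)\<close> for \<open>t = exp (\<i> \<theta>)\<close>, except at the initial point, which does not affect the integral.
\<close>

fun circle_integral ::
    "nat list \<Rightarrow> ((nat \<Rightarrow> complex) \<Rightarrow> complex) \<Rightarrow> (nat \<Rightarrow> complex) \<Rightarrow> complex" where
  "circle_integral [] F t = F t"
| "circle_integral (k # ks) F t =
     contour_integral (part_circlepath 0 1 (- pi) pi) (\<lambda>u. circle_integral ks F (t(k := u)))"

definition hypergeometric :: "complex list \<Rightarrow> complex list \<Rightarrow> complex \<Rightarrow> complex" where
  "hypergeometric as bs x = eval_fps (fps_hypergeo as bs 1) x"

lemma hypergeometric_altdef: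
  "hypergeometric as bs x =
     (\<Sum>n. (\<Prod>a\<leftarrow>as. pochhammer a n) / (\<Prod>b\<leftarrow>bs. pochhammer b n) * (x ^ n / fact n))"
proof -
  have foldl_eq: "foldl (\<lambda>r a. r * pochhammer a n) c cs = c * (\<Prod>a\<leftarrow>cs. pochhammer a n)"
    for n and c :: complex and cs
    by (induction cs arbitrary: c) (simp_all add: mult.assoc)
  show ?thesis
    by (simp add: hypergeometric_def eval_fps_def fps_hypergeo_def foldl_eq field_simps)
qed

definition pade_coeff :: "(nat \<Rightarrow> complex) \<Rightarrow> (nat \<Rightarrow> nat) \<Rightarrow> nat \<Rightarrow> nat \<Rightarrow> nat \<Rightarrow> complex" where
  "pade_coeff \<omega> \<rho> m k r = (let W = \<omega> k - \<omega> m in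
     if m = k then of_nat (\<rho> k choose r)
     else if \<rho> k < r then
       (- 1) ^ (\<rho> k + 1) * inverse (of_nat (r choose \<rho> k))
         * (Gamma (of_nat r + 1) / Gamma (of_nat r + 1 - W))
         * (Gamma (of_nat r - of_nat (\<rho> k) - W) / Gamma (of_nat r - of_nat (\<rho> k) + 1))
     else
       (- 1) ^ r * of_nat (\<rho> k choose r)
         * (Gamma (of_nat r + 1) / Gamma (of_nat r + 1 - W))
         * (Gamma (of_nat (\<rho> k) - of_nat r + 1) / Gamma (of_nat (\<rho> k) - of_nat r + 1 + W))
         * (of_real pi / sin (of_real pi * W)))"

end

theory Submission
  imports Defs
begin

text \<open>
  Expanding each \<open>H k\<close> in powers of \<open>1 - z\<close> turns the Pade form into \<open>\<Sum>i. c i * (1 - z) powr x i\<close>, where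
  the \<open>x i\<close> are the \<open>\<sigma>\<close> distinct nodes \<open>\<omega> k + r\<close> with \<open>r \<le> \<rho> k\<close>.  Its Taylor coefficients at \<open>0\<close> are
  the moments \<open>\<Sum>i. c i * (x i gchoose n)\<close> up to sign, so the Pade conditions prescribe the moments of
  all polynomials of degree below \<open>\<sigma>\<close>.  By Lagrange interpolation they have the unique solution
  \<open>c i = (- 1) ^ (\<sigma> - 1) / (\<Prod>j\<noteq>i. x i - x j)\<close>.  This is formula (ii), and these are also the residues
  in (i); in (iii) the binomial theorem splits the integrand into products of functions of one
  variable; (iv) and (v) rewrite the rising factorials.
\<close>

subsection \<open>Polynomial moments\<close>


lemma prod_linear_poly:
  fixes x :: "'i \<Rightarrow> 'a::field"
  shows "degree (\<Prod>j\<in>J. [:- x j, 1:]) = card J" "coeff (\<Prod>j\<in>J. [:- x j, 1:]) (card J) = 1"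
    "poly (\<Prod>j\<in>J. [:- x j, 1:]) y = (\<Prod>j\<in>J. y - x j)"
proof -
  show deg: "degree (\<Prod>j\<in>J. [:- x j, 1:]) = card J"
    by (subst degree_prod_eq_sum_degree) auto
  have "lead_coeff (\<Prod>j\<in>J. [:- x j, 1:]) = 1"
    unfolding lead_coeff_prod by simp
  thus "coeff (\<Prod>j\<in>J. [:- x j, 1:]) (card J) = 1" by (simp add: deg)
  show "poly (\<Prod>j\<in>J. [:- x j, 1:]) y = (\<Prod>j\<in>J. y - x j)"
    by (simp add: poly_prod)
qed

text \<open>The leading coefficient of the Lagrange interpolation formula for \<open>q\<close>.\<close>
lemma divided_difference_poly:
  fixes x :: "'i \<Rightarrow> 'a::field"
  assumes fin: "finite I" and inj: "inj_on x I" and deg: "degree q < card I"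
  shows "(\<Sum>i\<in>I. poly q (x i) / (\<Prod>j\<in>I - {i}. x i - x j)) = coeff q (card I - 1)"
proof -
  define N where "N i = (\<Prod>j\<in>I - {i}. [:- x j, 1:])" for i
  define w where "w i = (\<Prod>j\<in>I - {i}. x i - x j)" for i
  define L where "L = (\<Sum>i\<in>I. smult (poly q (x i) / w i) (N i))"
  have card: "card (I - {i}) = card I - 1" if "i \<in> I" for i
    using fin that by simp
  have w0: "w i \<noteq> 0" if "i \<in> I" for i
    using that fin inj by (auto simp: w_def inj_on_def)
  \<comment> \<open>Two polynomials of degree below \<open>card I\<close> that agree at
    \<open>card I\<close> distinct points coincide.\<close>
  have "L = q"
  proof (rule poly_eqI_degree[where A = "x ` I"])
    fix y assume "y \<in> x ` I"
    then obtain i where i: "i \<in> I" "y = x i" by blast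
    have "poly (N j) (x i) = (if j = i then w i else 0)" if "j \<in> I" for j
      using i that fin by (auto simp: N_def w_def prod_linear_poly(3))
    hence "poly L (x i) = (\<Sum>j\<in>I. if j = i then poly q (x i) else 0)"
      unfolding L_def poly_sum using w0 by (intro sum.cong) auto
    thus "poly L y = poly q y" using i fin by simp
  next
    have "degree L \<le> card I - 1"
      unfolding L_def
    proof (rule degree_sum_le[OF fin])
      fix i assume "i \<in> I"
      thus "degree (smult (poly q (x i) / w i) (N i)) \<le> card I - 1"
        using degree_smult_le[of "poly q (x i) / w i" "N i"]
        by (simp add: N_def prod_linear_poly(1) card)
    qed
    thus "card (x ` I) > degree L" using deg inj by (simp add: card_image)
  qed (use deg inj in \<open>simp add: card_image\<close>)
  hence "coeff q (card I - 1) = coeff L (card I - 1)" by simp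
  \<comment> \<open>Each \<open>N i\<close> is monic of degree \<open>card I - 1\<close>, so the top
    coefficient of \<open>L\<close> is the sum of the weights alone.\<close>
  also have "\<dots> = (\<Sum>i\<in>I. poly q (x i) / w i)"
    unfolding L_def coeff_sum
    by (intro sum.cong refl) (metis N_def card coeff_smult mult.right_neutral prod_linear_poly(2))
  finally show ?thesis by (simp add: w_def)
qed

text \<open>The product of the linear factors of all nodes except \<open>x i\<close> has degree
  \<open>card I - 1\<close> and vanishes at every other node, so its moment isolates
  \<open>c i\<close>. This yields uniqueness of the Pade family.\<close>

lemma vanishing_moments_imp_zero:
  fixes x c :: "'i \<Rightarrow> 'a::field"
  assumes fin: "finite I" and inj: "inj_on x I"
    and mom: "\<And>q. degree q < card I \<Longrightarrow> (\<Sum>i\<in>I. c i * poly q (x i)) = 0"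
    and i: "i \<in> I"
  shows "c i = 0"
proof -
  define N where "N = (\<Prod>j\<in>I - {i}. [:- x j, 1:])"
  have "card I > 0" using fin i by (auto simp: card_gt_0_iff)
  hence "degree N < card I" using fin i by (simp add: N_def prod_linear_poly(1))
  hence "0 = (\<Sum>j\<in>I. c j * poly N (x j))" using mom by simp
  also have "\<dots> = (\<Sum>j\<in>I. if j = i then c i * poly N (x i) else 0)"
    using fin by (intro sum.cong) (auto simp: N_def prod_linear_poly(3))
  also have "\<dots> = c i * poly N (x i)" using fin i by simp
  finally show ?thesis
    using fin i inj by (auto simp: N_def prod_linear_poly(3) inj_on_def)
qed

text \<open>The falling factorial of the indeterminate, kept as a polynomial so that its degree and
  leading coefficient can be used; its values are \<open>fact n\<close> times the binomial
  coefficients of the binomial series.\<close>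

definition falling_poly :: "nat \<Rightarrow> complex poly" where
  "falling_poly n = (\<Prod>i<n. [:- of_nat i, 1:])"

lemma falling_poly:
  "degree (falling_poly n) = n" "coeff (falling_poly n) n = 1"
  "poly (falling_poly n) a = fact n * (a gchoose n)"
  using prod_linear_poly(1,2)[of "\<lambda>i. of_nat i :: complex" "{..<n}"]
    prod_linear_poly(3)[of "\<lambda>i. of_nat i :: complex" "{..<n}" a]
  by (simp_all add: falling_poly_def gbinomial_mult_fact lessThan_atLeast0)

text \<open>The falling factorials are monic with one in each degree. Subtracting the multiple with
  the same leading coefficient lowers the degree of \<open>q\<close>, and induction on the degree
  handles the rest.\<close>

lemma gbinomial_moments_imp_moments:
  fixes c x :: "'i \<Rightarrow> complex"
  assumes "\<And>n. n < N \<Longrightarrow> (\<Sum>i\<in>I. c i * (x i gchoose n)) = 0" and "degree q < N"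
  shows "(\<Sum>i\<in>I. c i * poly q (x i)) = 0"
  using assms(2)
proof (induction "degree q" arbitrary: q rule: less_induct)
  case less
  define r where "r = q - smult (lead_coeff q) (falling_poly (degree q))"
  have q: "q = smult (lead_coeff q) (falling_poly (degree q)) + r" by (simp add: r_def)
  have "(\<Sum>i\<in>I. c i * poly (falling_poly (degree q)) (x i)) =
      fact (degree q) * (\<Sum>i\<in>I. c i * (x i gchoose degree q))"
    by (simp add: falling_poly(3) sum_distrib_left mult_ac)
  hence top: "(\<Sum>i\<in>I. c i * poly (falling_poly (degree q)) (x i)) = 0"
    using assms(1) less.prems by simp
  have r0: "(\<Sum>i\<in>I. c i * poly r (x i)) = 0"
  \<comment> \<open>A constant \<open>q\<close> leaves \<open>r = 0\<close>, whose degree is again 0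
    and not smaller; hence the induction hypothesis is kept for nonzero \<open>r\<close>.\<close>
  proof (cases "r = 0")
    case False
    have "degree r \<le> degree q" unfolding r_def
      by (intro degree_diff_le order.trans[OF degree_smult_le]) (simp_all add: falling_poly(1))
    moreover have "coeff r (degree q) = 0" by (simp add: r_def falling_poly(2))
    ultimately have "degree r < degree q"
      using False by (metis leading_coeff_0_iff order_le_less)
    thus ?thesis using less by simp
  qed simp
  have "(\<Sum>i\<in>I. c i * poly q (x i)) = lead_coeff q * (\<Sum>i\<in>I. c i * poly (falling_poly (degree q)) (x i))
      + (\<Sum>i\<in>I. c i * poly r (x i))"
    by (subst q) (simp add: sum_distrib_left sum.distrib algebra_simps del: coeff_diff)
  thus ?case using top r0 by simp
qed

subsection \<open>Taylor coefficients\<close>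

lemma has_fps_expansion_powr_one_minus:
  fixes a :: complex
  shows "(\<lambda>z. (1 - z) powr a) has_fps_expansion Abs_fps (\<lambda>n. (- 1) ^ n * (a gchoose n))"
proof (rule has_fps_expansionI)
  have "eventually (\<lambda>z::complex. z \<in> ball 0 1) (nhds 0)"
    by (intro eventually_nhds_in_open) auto
  thus "\<forall>\<^sub>F z in nhds 0. (\<lambda>n. fps_nth (Abs_fps (\<lambda>n. (- 1) ^ n * (a gchoose n))) n * z ^ n) sums (1 - z) powr a"
  proof eventually_elim
    case (elim z)
    hence "(\<lambda>n. (a gchoose n) * (- z) ^ n) sums (1 + - z) powr a"
      by (intro gen_binomial_complex) simp
    thus ?case by (simp add: power_minus[of z] mult_ac)
  qed
qed

lemma has_fps_expansion_powr_sum: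
  fixes c x :: "'i \<Rightarrow> complex"
  shows "(\<lambda>z. \<Sum>i\<in>I. c i * (1 - z) powr x i) has_fps_expansion
    Abs_fps (\<lambda>n. (- 1) ^ n * (\<Sum>i\<in>I. c i * (x i gchoose n)))"
proof -
  have "(\<lambda>z. \<Sum>i\<in>I. c i * (1 - z) powr x i) has_fps_expansion
      (\<Sum>i\<in>I. fps_const (c i) * Abs_fps (\<lambda>n. (- 1) ^ n * (x i gchoose n)))"
    by (intro fps_expansion_intros has_fps_expansion_powr_one_minus)
  also have "(\<Sum>i\<in>I. fps_const (c i) * Abs_fps (\<lambda>n. (- 1) ^ n * (x i gchoose n))) =
      Abs_fps (\<lambda>n. (- 1) ^ n * (\<Sum>i\<in>I. c i * (x i gchoose n)))"
    by (rule fps_ext) (simp add: fps_sum_nth sum_distrib_left mult_ac)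
  finally show ?thesis .
qed

text \<open>Once the singularity at 0 is filled with the \<open>n\<close>-th coefficient, the
  quotient has the shifted series as its expansion and is therefore continuous at 0.\<close>

lemma fps_expansion_tendsto_divide_power:
  fixes f :: "complex \<Rightarrow> complex"
  assumes f: "f has_fps_expansion F" and low: "\<And>k. k < n \<Longrightarrow> fps_nth F k = 0"
  shows "((\<lambda>z. f z / z ^ n) \<longlongrightarrow> fps_nth F n) (at 0)"
\<comment> \<open>The zero series has subdegree 0, so it does not satisfy
  \<open>n \<le> subdegree F\<close> in general and is treated apart.\<close>
proof (cases "F = 0")
  case True
  hence "eventually (\<lambda>z. f z = 0) (at 0)"
    using f by (auto simp: has_fps_expansion_def eventually_at_filter elim: eventually_mono)
  hence "eventually (\<lambda>z. f z / z ^ n = 0) (at 0)" by eventually_elim simp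
  thus ?thesis using True by (simp add: tendsto_eventually)
next
  case False
  hence "n \<le> subdegree F" by (meson low nth_subdegree_nonzero not_less)
  hence "(\<lambda>z. if z = 0 then fps_nth F n else f z / z ^ n) has_fps_expansion fps_shift n F"
    using f by (intro has_fps_expansion_shift) auto
  hence "isCont (\<lambda>z. if z = 0 then fps_nth F n else f z / z ^ n) 0"
    by (rule has_fps_expansion_imp_continuous)
  hence "((\<lambda>z. if z = 0 then fps_nth F n else f z / z ^ n) \<longlongrightarrow> fps_nth F n) (at 0)"
    by (simp add: isCont_def)
  thus ?thesis
    by (rule Lim_transform_eventually) (auto simp: eventually_at_filter)
qed

text \<open>Turns the limit in the Pade conditions into equations for Taylor coefficients. Once the
  coefficients below \<open>k\<close> vanish, the \<open>k\<close>-th is the limit of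
  \<open>f z / z ^ k\<close>; for \<open>k < n\<close> this is the convergent quotient times
  \<open>z ^ (n - k)\<close>, which tends to 0.\<close>

lemma tendsto_divide_power_iff_fps_nth:
  fixes f :: "complex \<Rightarrow> complex"
  assumes f: "f has_fps_expansion F"
  shows "((\<lambda>z. f z / z ^ n) \<longlongrightarrow> c) (at 0) \<longleftrightarrow> (\<forall>k<n. fps_nth F k = 0) \<and> fps_nth F n = c"
proof
  assume lim: "((\<lambda>z. f z / z ^ n) \<longlongrightarrow> c) (at 0)"
  have low: "fps_nth F k = 0" if "k < n" for k
    using that
  proof (induction k rule: less_induct)
    case (less k)
    have "((\<lambda>z. f z / z ^ n * z ^ (n - k)) \<longlongrightarrow> c * 0 ^ (n - k)) (at 0)"
      by (intro tendsto_intros lim)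
    hence "((\<lambda>z. f z / z ^ n * z ^ (n - k)) \<longlongrightarrow> 0) (at 0)"
      using less.prems by (simp add: zero_power)
    hence "((\<lambda>z. f z / z ^ k) \<longlongrightarrow> 0) (at 0)"
      by (rule Lim_transform_eventually)
         (use less.prems in \<open>auto simp: eventually_at_filter power_diff field_simps\<close>)
    moreover have "((\<lambda>z. f z / z ^ k) \<longlongrightarrow> fps_nth F k) (at 0)"
      by (rule fps_expansion_tendsto_divide_power[OF f]) (use less in auto)
    ultimately show ?case by (rule LIM_unique[rotated])
  qed
  moreover have "fps_nth F n = c"
    using fps_expansion_tendsto_divide_power[OF f low] lim by (rule LIM_unique)
  ultimately show "(\<forall>k<n. fps_nth F k = 0) \<and> fps_nth F n = c" by blast
qed (use fps_expansion_tendsto_divide_power[OF f] in blast)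

subsection \<open>Rising factorials and Gamma functions\<close>

text \<open>The indices below \<open>r\<close> contribute \<open>fact r\<close>; those above
  contribute \<open>fact (n - r)\<close> with one sign each. Accordingly the induction on
  \<open>n\<close> starts at \<open>r\<close>.\<close>

lemma prod_of_nat_diff_omit:
  "(\<Prod>i\<in>{..n} - {r}. of_nat r - of_nat i) = (- 1) ^ (n - r) * fact r * (fact (n - r) :: 'a::field_char_0)"
  if "r \<le> n" for r n :: nat
  using that
proof (induction n rule: dec_induct)
  case base
  have "{..r} - {r} = {..<r}" by auto
  moreover have "(\<Prod>i<r. of_nat r - of_nat i) = (of_nat (\<Prod>i<r. r - i) :: 'a)"
    by (simp add: of_nat_prod of_nat_diff)
  moreover have "(\<Prod>i<r. r - i) = fact r"
    by (simp add: fact_prod_rev lessThan_atLeast0)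
  ultimately show ?case by simp
next
  case (step n)
  hence eq: "{..Suc n} - {r} = insert (Suc n) ({..n} - {r})" by auto
  have "(of_nat r - of_nat (Suc n) :: 'a) = - of_nat (Suc n - r)"
    using step.hyps by (simp add: of_nat_diff)
  thus ?case unfolding eq
    using step by (simp add: Suc_diff_le algebra_simps)
qed

lemma prod_diff_conv_pochhammer:
  fixes a :: "'a::comm_ring_1"
  shows "(\<Prod>i\<le>n. a - of_nat i) = (- 1) ^ (n + 1) * pochhammer (- a) (n + 1)"
proof -
  have "(\<Prod>i\<le>n. a - of_nat i) = (\<Prod>i\<le>n. (- 1) * (- a + of_nat i))" by simp
  also have "\<dots> = (- 1) ^ (n + 1) * (\<Prod>i\<le>n. - a + of_nat i)"
    by (simp only: prod.distrib prod_constant card_atMost Suc_eq_plus1)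
  finally show ?thesis
    by (simp add: pochhammer_prod atLeast0LessThan lessThan_Suc_atMost del: prod.op_ivl_Suc)
qed

text \<open>The substitution of \<open>1 - z\<close> for \<open>z\<close> is an involution, so
  composing with it gives the coefficients in powers of \<open>1 - z\<close>. A summation bound
  \<open>n\<close> above the degree allows a fixed index set.\<close>

lemma poly_pcompose_one_minus:
  fixes p :: "'a::comm_ring_1 poly"
  assumes "degree p \<le> n"
  shows "poly p z = (\<Sum>r\<le>n. coeff (p \<circ>\<^sub>p [:1, - 1:]) r * (1 - z) ^ r)"
proof -
  let ?q = "p \<circ>\<^sub>p [:1, - 1:]"
  have "degree ?q \<le> n"
    using degree_pcompose_le[of p "[:1, - 1:]"] assms by simp
  have "poly p z = poly ?q (1 - z)" by (simp add: poly_pcompose)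
  also have "\<dots> = (\<Sum>r\<le>degree ?q. coeff ?q r * (1 - z) ^ r)" by (rule poly_altdef)
  also have "\<dots> = (\<Sum>r\<le>n. coeff ?q r * (1 - z) ^ r)"
    using \<open>degree ?q \<le> n\<close> by (intro sum.mono_neutral_left) (auto simp: coeff_eq_0)
  finally show ?thesis .
qed

lemma pochhammer_one_minus:
  fixes a :: "'a::comm_ring_1"
  shows "pochhammer (1 - a) r = (- 1) ^ r * pochhammer (a - of_nat r) r"
  using pochhammer_minus[of "a - 1" r] by simp

text \<open>The product of the \<open>r + n + 1\<close> consecutive factors from
  \<open>a - of_nat r\<close> on is split once after \<open>r\<close> factors and once after
  \<open>n + 1\<close>; reversing the two pieces of length \<open>r\<close> gives the identity. It
  moves the shift by \<open>r\<close> into hypergeometric parameters.\<close>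

lemma pochhammer_shift_ratio:
  fixes a :: "'a::comm_ring_1"
  shows "pochhammer (a - of_nat r) (n + 1) * pochhammer (- a - of_nat n) r =
    pochhammer a (n + 1) * pochhammer (1 - a) r"
proof -
  let ?p = "pochhammer (a - of_nat r) (n + 1)" and ?q = "pochhammer (a + of_nat n + 1 - of_nat r) r"
  have "pochhammer (a - of_nat r) (r + (n + 1)) = pochhammer (a - of_nat r) r * pochhammer a (n + 1)"
    by (subst pochhammer_product') simp
  moreover have "pochhammer (a - of_nat r) ((n + 1) + r) = ?p * ?q"
    by (subst pochhammer_product') (simp add: algebra_simps)
  ultimately have swap: "?p * ?q = pochhammer a (n + 1) * pochhammer (a - of_nat r) r"
    by (simp only: add.commute mult.commute)
  have "pochhammer (- a - of_nat n) r = (- 1) ^ r * ?q"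
    using pochhammer_minus[of "a + of_nat n" r] by (simp add: algebra_simps)
  hence "?p * pochhammer (- a - of_nat n) r = (- 1) ^ r * (?p * ?q)"
    by (simp only: mult.left_commute)
  thus ?thesis
    unfolding swap pochhammer_one_minus by (simp only: mult.left_commute)
qed

section \<open>Sines and Gamma quotients at non-integral arguments\<close>

lemma sin_pi_times_nonzero:
  fixes W :: complex
  assumes "W \<notin> \<int>"
  shows "sin (of_real pi * W) \<noteq> 0"
proof
  assume "sin (of_real pi * W) = 0"
  then obtain n :: int where "of_real pi * W = of_real (of_int n * pi)"
    by (auto simp: sin_eq_0)
  hence "W = of_int n" by simp
  thus False using assms by simp
qed

lemma sin_pi_times_diff_of_nat:
  fixes W :: complex
  shows "sin (of_real pi * (W - of_nat r)) = (- 1) ^ r * sin (of_real pi * W)"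
proof (induction r)
  case (Suc r)
  have "of_real pi * (W - of_nat (Suc r)) = of_real pi * (W - of_nat r) - of_real pi"
    by (simp add: algebra_simps)
  thus ?case by (simp add: Suc sin_diff)
qed simp

text \<open>Reversing the factors gives a rising factorial from
  \<open>of_nat r - of_nat n - W\<close> on, hence a Gamma quotient; as \<open>W\<close> is not an
  integer, no pole is met.\<close>

lemma pochhammer_conv_Gamma_less:
  fixes W :: complex
  assumes "W \<notin> \<int>"
  shows "pochhammer (W - of_nat r) (n + 1) =
    (- 1) ^ (n + 1) * Gamma (of_nat r + 1 - W) / Gamma (of_nat r - of_nat n - W)"
proof -
  have "of_nat r - of_nat n - W \<notin> \<int>"
    using assms by (metis Ints_diff Ints_of_nat diff_diff_eq2 add_diff_cancel_left' diff_add_cancel)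
  hence *: "of_nat r - of_nat n - W \<notin> \<int>\<^sub>\<le>\<^sub>0"
    using nonpos_Ints_subset_Ints by blast
  have "pochhammer (W - of_nat r) (n + 1) =
      (- 1) ^ (n + 1) * pochhammer (of_nat r - of_nat n - W) (n + 1)"
    using pochhammer_minus[of "of_nat r - W" "n + 1"] by (simp add: algebra_simps)
  also have "pochhammer (of_nat r - of_nat n - W) (n + 1) =
      Gamma (of_nat r + 1 - W) / Gamma (of_nat r - of_nat n - W)"
    using pochhammer_Gamma[OF *, of "n + 1"] by (simp add: algebra_simps)
  finally show ?thesis by simp
qed

text \<open>The rising factorial is a Gamma quotient with denominator
  \<open>Gamma (W - of_nat r)\<close>. The reflection formula replaces this value, and
  \<open>(- 1) ^ r\<close> comes from shifting the sine by \<open>r\<close> half periods.\<close>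

lemma pochhammer_conv_Gamma_reflected:
  fixes W :: complex
  assumes "W \<notin> \<int>"
  shows "1 / pochhammer (W - of_nat r) (n + 1) =
    (- 1) ^ r / (Gamma (of_nat r + 1 - W) * Gamma (of_nat n - of_nat r + 1 + W)) *
      (of_real pi / sin (of_real pi * W))"
proof -
  have "W - of_nat r \<notin> \<int>"
    using assms by (metis Ints_add Ints_of_nat diff_add_cancel)
  hence *: "W - of_nat r \<notin> \<int>\<^sub>\<le>\<^sub>0"
    using nonpos_Ints_subset_Ints by blast
  have "1 + of_nat r - W \<notin> \<int>"
    using assms by (metis Ints_add Ints_diff Ints_of_nat Ints_1 diff_diff_eq2 add_diff_cancel_left')
  hence "1 + of_nat r - W \<notin> \<int>\<^sub>\<le>\<^sub>0"
    using nonpos_Ints_subset_Ints by blast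
  hence G: "Gamma (1 + of_nat r - W) \<noteq> 0" by (simp add: Gamma_eq_zero_iff)
  have poch: "pochhammer (W - of_nat r) (n + 1) =
      Gamma (of_nat n - of_nat r + 1 + W) / Gamma (W - of_nat r)"
    using pochhammer_Gamma[OF *, of "n + 1"] by (simp add: algebra_simps)
  have "Gamma (W - of_nat r) * Gamma (1 + of_nat r - W) =
      of_real pi / sin (of_real pi * (W - of_nat r))"
    using Gamma_reflection_complex[of "W - of_nat r"] by (simp add: algebra_simps)
  hence "Gamma (W - of_nat r) =
      of_real pi / sin (of_real pi * (W - of_nat r)) / Gamma (1 + of_nat r - W)"
    using G by (metis nonzero_mult_div_cancel_right)
  hence "Gamma (W - of_nat r) =
      (- 1) ^ r * (of_real pi / sin (of_real pi * W)) / Gamma (1 + of_nat r - W)"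
    unfolding sin_pi_times_diff_of_nat by (cases "even r") simp_all
  thus ?thesis unfolding poch by (simp add: add_ac)
qed

text \<open>This is the partial fraction expansion of the reciprocal rising factorial. By Pascal's
  rule the sum for \<open>Suc n\<close> at \<open>s\<close> is the sum for \<open>n\<close> at
  \<open>s\<close> minus the sum for \<open>n\<close> at \<open>s + 1\<close>.\<close>

lemma alternating_binomial_partial_fractions:
  fixes s :: "'a::field_char_0"
  assumes "\<And>j. s + of_nat j \<noteq> 0"
  shows "(\<Sum>j\<le>n. (- 1) ^ j * of_nat (n choose j) / (s + of_nat j)) = fact n / pochhammer s (n + 1)"
  using assms
proof (induction n arbitrary: s)
  case 0
  thus ?case by simp
next
  case (Suc n)
  define f where "f j = 1 / (s + of_nat j)" for j
  have nz: "s + 1 + of_nat j \<noteq> 0" for j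
    using Suc.prems[of "Suc j"] by (simp add: add_ac)
  have p: "pochhammer (s + 1) n \<noteq> 0"
    using nz by (simp add: pochhammer_prod)
  have "(\<Sum>j\<le>Suc n. (- 1) ^ j * of_nat (Suc n choose j) * f j) =
      f 0 + (\<Sum>j\<le>n. (- 1) ^ Suc j * of_nat (Suc n choose Suc j) * f (Suc j))"
    by (subst sum.atMost_Suc_shift) simp
  also have "\<dots> = (f 0 + (\<Sum>j\<le>n. (- 1) ^ Suc j * of_nat (n choose Suc j) * f (Suc j))) -
      (\<Sum>j\<le>n. (- 1) ^ j * of_nat (n choose j) * f (Suc j))"
    unfolding add_diff_eq[symmetric] sum_subtractf[symmetric]
    by (intro arg_cong2[where f = "(+)"] sum.cong refl) (simp add: algebra_simps)
  also have "f 0 + (\<Sum>j\<le>n. (- 1) ^ Suc j * of_nat (n choose Suc j) * f (Suc j)) =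
      (\<Sum>j\<le>Suc n. (- 1) ^ j * of_nat (n choose j) * f j)"
    by (subst sum.atMost_Suc_shift) simp
  \<comment> \<open>The last term drops out because \<open>n choose Suc n\<close> is 0.\<close>
  also have "\<dots> = (\<Sum>j\<le>n. (- 1) ^ j * of_nat (n choose j) * f j)" by simp
  also have "\<dots> = fact n / pochhammer s (n + 1)"
    using Suc.IH[OF Suc.prems] by (simp add: f_def)
  also have "(\<Sum>j\<le>n. (- 1) ^ j * of_nat (n choose j) * f (Suc j)) = fact n / pochhammer (s + 1) (n + 1)"
    using Suc.IH[OF nz] by (simp add: f_def add_ac)
  also have "fact n / pochhammer s (n + 1) - fact n / pochhammer (s + 1) (n + 1) =
      fact (Suc n) / pochhammer s (Suc n + 1)"
  proof -
    \<comment> \<open>The two fractions share the factor \<open>pochhammer (s + 1) n\<close>; what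
      remains is the difference of the reciprocals of \<open>s\<close> and \<open>t\<close>, and
      \<open>t - s\<close> is the new factor \<open>n + 1\<close> of the factorial.\<close>
    define t where "t = s + 1 + of_nat n"
    have 1: "pochhammer s (n + 1) = s * pochhammer (s + 1) n"
      and 2: "pochhammer (s + 1) (n + 1) = t * pochhammer (s + 1) n"
      and 3: "pochhammer s (Suc n + 1) = s * (t * pochhammer (s + 1) n)"
      using pochhammer_rec[of s n] pochhammer_rec'[of "s + 1" n] pochhammer_rec[of s "Suc n"]
      by (simp_all add: t_def)
    have "fact (Suc n) = (t - s) * fact n" by (simp add: t_def)
    moreover have "t \<noteq> 0" "s \<noteq> 0" using nz[of n] Suc.prems[of 0] by (simp_all add: t_def)
    ultimately show ?thesis
      unfolding 1 2 3 using p by (simp add: field_simps del: fact_Suc)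
  qed
  finally show ?case by (simp add: f_def)
qed

subsection \<open>Integrals over the unit circle\<close>

lemma has_integral_exp_symmetric_interval:
  fixes s :: complex
  assumes "s \<noteq> 0"
  shows "((\<lambda>\<theta>. exp (\<i> * s * of_real \<theta>)) has_integral 2 * sin (of_real pi * s) / s) {- pi..pi}"
proof -
  let ?F = "\<lambda>\<theta>::real. exp (\<i> * s * of_real \<theta>) / (\<i> * s)"
  have "((\<lambda>\<theta>. exp (\<i> * s * of_real \<theta>)) has_integral (?F pi - ?F (- pi))) {- pi..pi}"
  proof (rule fundamental_theorem_of_calculus)
    fix x :: real
    have "((\<lambda>w. exp (\<i> * s * w) / (\<i> * s)) has_field_derivative exp (\<i> * s * of_real x)) (at (of_real x))"
      using assms by (auto intro!: derivative_eq_intros)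
    thus "(?F has_vector_derivative exp (\<i> * s * of_real x)) (at x within {- pi..pi})"
      using has_vector_derivative_real_field by blast
  qed simp
  also have "?F pi - ?F (- pi) = 2 * sin (of_real pi * s) / s"
    using assms by (simp add: sin_exp_eq field_simps)
  finally show ?thesis .
qed

text \<open>The angle \<open>- pi\<close> is excluded because the principal logarithm of -1 has
  argument \<open>pi\<close>.\<close>

lemma cis_powr:
  assumes "- pi < \<theta>" "\<theta> \<le> pi"
  shows "cis \<theta> powr a = exp (\<i> * a * of_real \<theta>)"
proof -
  have "Ln (cis \<theta>) = \<i> * of_real \<theta>"
    unfolding cis_conv_exp using assms by (intro Ln_exp) auto
  thus ?thesis by (simp add: powr_def mult_ac)
qed

text \<open>Expanding \<open>(1 + t) ^ n\<close> leaves exponentials in the angle with frequencies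
  \<open>W - r + j\<close>, nonzero since \<open>W = b - a\<close> is not an integer. Each
  integrates to twice a sine over its frequency; all these sines agree up to sign, and an
  alternating partial fraction sum remains.\<close>

lemma has_contour_integral_powr_circle:
  fixes a b :: complex
  assumes "b - a \<notin> \<int>"
  shows "((\<lambda>t. t powr (- a - 1) * (t powr b * (1 + t) ^ n) * (1 / t) ^ r) has_contour_integral
    2 * \<i> * sin (of_real pi * (b - a)) * ((- 1) ^ r * fact n / pochhammer (b - a - of_nat r) (n + 1)))
    (part_circlepath 0 1 (- pi) pi)"
proof -
  define W where "W = b - a"
  have nz: "W - of_nat r + of_nat j \<noteq> 0" for j
  proof
    assume "W - of_nat r + of_nat j = 0"
    hence "W = of_nat r - of_nat j" by (simp add: algebra_simps)
    also have "\<dots> \<in> \<int>" by simp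
    finally show False using assms by (simp add: W_def)
  qed
  let ?f = "\<lambda>t. t powr (- a - 1) * (t powr b * (1 + t) ^ n) * (1 / t) ^ r"
  let ?I = "\<Sum>j\<le>n. \<i> * of_nat (n choose j) *
    (2 * sin (of_real pi * (W - of_nat r + of_nat j)) / (W - of_nat r + of_nat j))"
  have "((\<lambda>\<theta>. \<Sum>j\<le>n. \<i> * of_nat (n choose j) * exp (\<i> * (W - of_nat r + of_nat j) * of_real \<theta>))
      has_integral ?I) {- pi..pi}"
    by (intro has_integral_sum has_integral_mult_right has_integral_exp_symmetric_interval nz) auto
  hence "((\<lambda>\<theta>. ?f (0 + of_real 1 * cis \<theta>) * of_real 1 * \<i> * cis \<theta>) has_integral ?I) {- pi..pi}"
  \<comment> \<open>The integrands are compared away from the single angle \<open>- pi\<close>,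
    where the principal power jumps.\<close>
  proof (rule has_integral_spike_finite[rotated 2])
    fix \<theta> assume "\<theta> \<in> {- pi..pi} - {- pi}"
    hence \<theta>: "- pi < \<theta>" "\<theta> \<le> pi" by auto
    have c: "cis \<theta> = exp (\<i> * of_real \<theta>)" by (rule cis_conv_exp)
    \<comment> \<open>The last factor \<open>cis \<theta>\<close> is the one from \<open>dt\<close>;
      it cancels the -1 in the exponent \<open>- a - 1\<close>.\<close>
    have term_eq: "exp (\<i> * (- a - 1) * of_real \<theta>) * exp (\<i> * b * of_real \<theta>) * (1 / cis \<theta>) ^ r * cis \<theta> ^ j * cis \<theta> =
        exp (\<i> * (W - of_nat r + of_nat j) * of_real \<theta>)" for j
    proof -
      have "(1 / cis \<theta>) ^ r = exp (of_nat r * (- (\<i> * of_real \<theta>)))"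
        unfolding c exp_of_nat_mult exp_minus by (simp add: divide_inverse)
      moreover have "cis \<theta> ^ j = exp (of_nat j * (\<i> * of_real \<theta>))"
        unfolding c exp_of_nat_mult ..
      ultimately show ?thesis
        unfolding c by (simp only: exp_add[symmetric]) (simp add: W_def algebra_simps)
    qed
    have "(1 + cis \<theta>) ^ n = (\<Sum>j\<le>n. of_nat (n choose j) * cis \<theta> ^ j)"
      using binomial_ring[of "cis \<theta>" 1 n] by (simp add: add.commute)
    hence "?f (cis \<theta>) * \<i> * cis \<theta> = (\<Sum>j\<le>n. \<i> * of_nat (n choose j) *
        (exp (\<i> * (- a - 1) * of_real \<theta>) * exp (\<i> * b * of_real \<theta>) * (1 / cis \<theta>) ^ r * cis \<theta> ^ j * cis \<theta>))"
      unfolding cis_powr[OF \<theta>] by (simp add: sum_distrib_left sum_distrib_right mult_ac)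
    thus "?f (0 + of_real 1 * cis \<theta>) * of_real 1 * \<i> * cis \<theta> =
        (\<Sum>j\<le>n. \<i> * of_nat (n choose j) * exp (\<i> * (W - of_nat r + of_nat j) * of_real \<theta>))"
      unfolding term_eq by simp
  qed auto
  hence "(?f has_contour_integral ?I) (part_circlepath 0 1 (- pi) pi)"
    by (subst has_contour_integral_part_circlepath_iff) auto
  also have "?I = 2 * \<i> * sin (of_real pi * W) * (- 1) ^ r *
      (\<Sum>j\<le>n. (- 1) ^ j * of_nat (n choose j) / (W - of_nat r + of_nat j))"
    unfolding sum_distrib_left
  proof (rule sum.cong[OF refl])
    fix j
    have "sin (of_real pi * ((W - of_nat r + of_nat j) - of_nat j)) =
        (- 1) ^ j * sin (of_real pi * (W - of_nat r + of_nat j))"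
      by (rule sin_pi_times_diff_of_nat)
    hence "sin (of_real pi * (W - of_nat r + of_nat j)) = (- 1) ^ j * ((- 1) ^ r * sin (of_real pi * W))"
      by (cases "even j") (simp_all add: sin_pi_times_diff_of_nat)
    thus "\<i> * of_nat (n choose j) * (2 * sin (of_real pi * (W - of_nat r + of_nat j)) / (W - of_nat r + of_nat j)) =
        2 * \<i> * sin (of_real pi * W) * (- 1) ^ r * ((- 1) ^ j * of_nat (n choose j) / (W - of_nat r + of_nat j))"
      by simp
  qed
  also have "\<dots> = 2 * \<i> * sin (of_real pi * W) * ((- 1) ^ r * fact n / pochhammer (W - of_nat r) (n + 1))"
    by (subst alternating_binomial_partial_fractions[OF nz]) simp
  finally show ?thesis by (simp only: W_def)
qed

text \<open>Only one factor of each summand depends on the outermost variable, so the integrals come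
  out one at a time. Factors of variables outside \<open>ks\<close> stay evaluated at
  \<open>t\<close>, which lets the induction pass through the updates of \<open>t\<close>.\<close>

lemma circle_integral_sum_prod:
  assumes "finite R" "finite K" "set ks \<subseteq> K" "distinct ks"
    and "\<And>r k. r \<in> R \<Longrightarrow> k \<in> K \<Longrightarrow> g r k contour_integrable_on part_circlepath 0 1 (- pi) pi"
  shows "circle_integral ks (\<lambda>t. \<Sum>r\<in>R. a r * (\<Prod>k\<in>K. g r k (t k))) t =
    (\<Sum>r\<in>R. a r * (\<Prod>k\<in>K - set ks. g r k (t k)) *
      (\<Prod>k\<in>set ks. contour_integral (part_circlepath 0 1 (- pi) pi) (g r k)))"
  using assms(3,4)
proof (induction ks arbitrary: t)
  case (Cons k ks)
  let ?C = "part_circlepath 0 1 (- pi) pi"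
  \<comment> \<open>\<open>A r\<close> collects everything that does not depend on the outermost
    variable.\<close>
  define A where "A r = a r * (\<Prod>j\<in>K - set (k # ks). g r j (t j)) *
    (\<Prod>j\<in>set ks. contour_integral ?C (g r j))" for r
  have "a r * (\<Prod>j\<in>K - set ks. g r j ((t(k := u)) j)) * (\<Prod>j\<in>set ks. contour_integral ?C (g r j)) =
      A r * g r k u" for r u
  proof -
    have eq: "K - set ks = insert k (K - set (k # ks))" using Cons.prems by auto
    have "(\<Prod>j\<in>K - set ks. g r j ((t(k := u)) j)) = g r k u * (\<Prod>j\<in>K - set (k # ks). g r j (t j))"
      unfolding eq using assms(2) by (subst prod.insert) (auto intro!: prod.cong)
    thus ?thesis by (simp add: A_def)
  qed
  hence "circle_integral (k # ks) (\<lambda>t. \<Sum>r\<in>R. a r * (\<Prod>k\<in>K. g r k (t k))) t =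
      contour_integral ?C (\<lambda>u. \<Sum>r\<in>R. A r * g r k u)"
    using Cons by simp
  also have "\<dots> = (\<Sum>r\<in>R. A r * contour_integral ?C (g r k))"
    using assms(1,5) Cons.prems
    by (simp add: contour_integral_sum contour_integral_lmul contour_integrable_lmul)
  also have "\<dots> = (\<Sum>r\<in>R. a r * (\<Prod>j\<in>K - set (k # ks). g r j (t j)) *
      (\<Prod>j\<in>set (k # ks). contour_integral ?C (g r j)))"
    using Cons.prems by (simp add: A_def mult_ac)
  finally show ?case .
qed simp

subsection \<open>The Pade system\<close>

locale pade_data =
  fixes M :: nat and \<omega> :: "nat \<Rightarrow> complex" and \<rho> :: "nat \<Rightarrow> nat"
  assumes nonint: "\<And>i j. i \<le> M \<Longrightarrow> j \<le> M \<Longrightarrow> i \<noteq> j \<Longrightarrow> \<omega> i - \<omega> j \<notin> \<int>"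
begin

section \<open>Nodes and the products of their differences\<close>

definition nodes :: "(nat \<times> nat) set" where
  "nodes = Sigma {..M} (\<lambda>k. {..\<rho> k})"

definition node :: "nat \<times> nat \<Rightarrow> complex" where
  "node i = \<omega> (fst i) + of_nat (snd i)"

text \<open>The coefficient of \<open>(z - 1) ^ r\<close> in the \<open>m\<close>-th Pade
  approximant; all five expressions are reduced to it.\<close>

definition pcoef :: "nat \<Rightarrow> nat \<Rightarrow> complex" where
  "pcoef m r = of_nat (\<rho> m choose r) / fact (\<rho> m) *
     (\<Prod>k\<in>{..M} - {m}. 1 / pochhammer (\<omega> k - \<omega> m - of_nat r) (\<rho> k + 1))"

lemma finite_nodes [simp]: "finite nodes" by (simp add: nodes_def)

lemma card_nodes: "card nodes = pade_sigma M \<rho>"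
  by (simp add: nodes_def pade_sigma_def)

lemma pade_sigma_pos: "pade_sigma M \<rho> > 0"
  unfolding pade_sigma_def by (rule sum_pos) auto

lemma diff_nonzero:
  assumes "k \<le> M" "m \<le> M" "k \<noteq> m"
  shows "\<omega> k - \<omega> m - of_nat r + of_nat i \<noteq> 0"
proof
  assume "\<omega> k - \<omega> m - of_nat r + of_nat i = 0"
  hence "\<omega> k - \<omega> m = of_nat r - of_nat i" by (simp add: algebra_simps)
  also have "\<dots> \<in> \<int>" by simp
  finally show False using nonint assms by blast
qed

lemma pochhammer_nonzero:
  assumes "k \<le> M" "m \<le> M" "k \<noteq> m"
  shows "pochhammer (\<omega> k - \<omega> m - of_nat r) n \<noteq> 0"
  using diff_nonzero[OF assms, of r] by (simp add: pochhammer_prod)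

lemma inj_on_node: "inj_on node nodes"
proof (rule inj_onI)
  fix i j assume ij: "i \<in> nodes" "j \<in> nodes" "node i = node j"
  have "fst i = fst j"
  proof (rule ccontr)
    assume "fst i \<noteq> fst j"
    with ij diff_nonzero[of "fst i" "fst j" "snd j" "snd i"]
    show False by (auto simp: nodes_def node_def algebra_simps)
  qed
  with ij show "i = j" by (auto simp: node_def prod_eq_iff)
qed

text \<open>The nodes with first index other than \<open>m\<close> form complete blocks, each a
  rising factorial up to sign; the block of \<open>m\<close> lacks the node itself and gives two
  factorials.\<close>

lemma node_prod:
  assumes m: "m \<le> M" and r: "r \<le> \<rho> m"
  shows "(\<Prod>j\<in>nodes - {(m, r)}. node (m, r) - node j) =
    (\<Prod>k\<in>{..M} - {m}. (- 1) ^ (\<rho> k + 1) * pochhammer (\<omega> k - \<omega> m - of_nat r) (\<rho> k + 1)) *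
    ((- 1) ^ (\<rho> m - r) * fact r * fact (\<rho> m - r))"
proof -
  have split: "nodes - {(m, r)} =
      Sigma ({..M} - {m}) (\<lambda>k. {..\<rho> k}) \<union> {m} \<times> ({..\<rho> m} - {r})"
    using m by (auto simp: nodes_def)
  have "(\<Prod>j\<in>nodes - {(m, r)}. node (m, r) - node j) =
      (\<Prod>j\<in>Sigma ({..M} - {m}) (\<lambda>k. {..\<rho> k}). node (m, r) - node j) *
      (\<Prod>j\<in>{m} \<times> ({..\<rho> m} - {r}). node (m, r) - node j)"
    unfolding split by (rule prod.union_disjoint) auto
  also have "(\<Prod>j\<in>Sigma ({..M} - {m}) (\<lambda>k. {..\<rho> k}). node (m, r) - node j) =
      (\<Prod>k\<in>{..M} - {m}. \<Prod>i\<le>\<rho> k. (\<omega> m + of_nat r - \<omega> k) - of_nat i)"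
    by (subst prod.Sigma) (auto simp: node_def algebra_simps intro!: prod.cong)
  also have "\<dots> = (\<Prod>k\<in>{..M} - {m}. (- 1) ^ (\<rho> k + 1) * pochhammer (\<omega> k - \<omega> m - of_nat r) (\<rho> k + 1))"
    unfolding prod_diff_conv_pochhammer by (simp add: algebra_simps)
  also have "(\<Prod>j\<in>{m} \<times> ({..\<rho> m} - {r}). node (m, r) - node j) = (\<Prod>i\<in>{..\<rho> m} - {r}. of_nat r - of_nat i)"
    by (rule prod.reindex_bij_witness[of _ "Pair m" snd]) (auto simp: node_def)
  also have "\<dots> = (- 1) ^ (\<rho> m - r) * fact r * fact (\<rho> m - r)"
    using r by (rule prod_of_nat_diff_omit)
  finally show ?thesis .
qed

text \<open>Up to sign, the numbers \<^const>\<open>pcoef\<close> are the partial fraction coefficients of the reciprocal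
  of the polynomial whose roots are the nodes.\<close>
lemma pcoef_conv_node_prod:
  assumes m: "m \<le> M" and r: "r \<le> \<rho> m"
  shows "(- 1) ^ r * pcoef m r =
    (- 1) ^ (pade_sigma M \<rho> - 1) / (\<Prod>j\<in>nodes - {(m, r)}. node (m, r) - node j)"
proof -
  define P where "P = (\<Prod>k\<in>{..M} - {m}. pochhammer (\<omega> k - \<omega> m - of_nat r) (\<rho> k + 1))"
  define S where "S = (\<Sum>k\<in>{..M} - {m}. \<rho> k + 1)"
  have P: "P \<noteq> 0" unfolding P_def using pochhammer_nonzero m by auto
  have S: "pade_sigma M \<rho> - 1 = S + \<rho> m"
    using sum.remove[of "{..M}" m "\<lambda>k. \<rho> k + 1"] m by (simp add: pade_sigma_def S_def)
  have sgn: "(\<Prod>k\<in>{..M} - {m}. (- 1) ^ (\<rho> k + 1)) = (- 1 :: complex) ^ S"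
    unfolding S_def by (simp only: power_sum)
  have bin: "(of_nat (\<rho> m choose r) :: complex) = fact (\<rho> m) / (fact r * fact (\<rho> m - r))"
    using r by (rule binomial_fact)
  \<comment> \<open>The signs \<open>(- 1) ^ S\<close> and \<open>(- 1) ^ (\<rho> m - r)\<close>
    cancel against those of the node product, which leaves \<open>(- 1) ^ r\<close>.\<close>
  have pow: "(- 1 :: complex) ^ (S + \<rho> m) = (- 1) ^ S * (- 1) ^ r * (- 1) ^ (\<rho> m - r)"
    using r by (simp flip: power_add)
  have "pcoef m r = 1 / (fact r * fact (\<rho> m - r) * P)"
    unfolding pcoef_def bin P_def prod_dividef by simp
  moreover have "(\<Prod>j\<in>nodes - {(m, r)}. node (m, r) - node j) =
      (- 1) ^ S * P * ((- 1) ^ (\<rho> m - r) * fact r * fact (\<rho> m - r))"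
    unfolding node_prod[OF assms] prod.distrib sgn P_def ..
  ultimately show ?thesis
    unfolding S pow using P by (simp add: field_simps)
qed

section \<open>The Pade conditions as moment equations\<close>

lemma pade_form_conv_powr_sum:
  assumes "\<And>k. k \<le> M \<Longrightarrow> degree (H k) \<le> \<rho> k" and "z \<noteq> 1"
  shows "pade_form M \<omega> H z =
    (\<Sum>i\<in>nodes. coeff (H (fst i) \<circ>\<^sub>p [:1, - 1:]) (snd i) * (1 - z) powr node i)"
proof -
  have "pade_form M \<omega> H z =
      (\<Sum>k\<le>M. \<Sum>r\<le>\<rho> k. coeff (H k \<circ>\<^sub>p [:1, - 1:]) r * (1 - z) powr node (k, r))"
    unfolding pade_form_def
  proof (rule sum.cong[OF refl])
    fix k assume "k \<in> {..M}"
    hence "poly (H k) z * (1 - z) powr \<omega> k =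
        (\<Sum>r\<le>\<rho> k. coeff (H k \<circ>\<^sub>p [:1, - 1:]) r * (1 - z) ^ r) * (1 - z) powr \<omega> k"
      by (subst poly_pcompose_one_minus[of _ "\<rho> k"]) (simp_all add: assms)
    also have "\<dots> = (\<Sum>r\<le>\<rho> k. coeff (H k \<circ>\<^sub>p [:1, - 1:]) r * (1 - z) powr node (k, r))"
      using assms(2) unfolding sum_distrib_right
      by (intro sum.cong) (auto simp: node_def powr_add powr_nat')
    finally show "poly (H k) z * (1 - z) powr \<omega> k = \<dots>" .
  qed
  also have "\<dots> = (\<Sum>i\<in>nodes. coeff (H (fst i) \<circ>\<^sub>p [:1, - 1:]) (snd i) * (1 - z) powr node i)"
    unfolding nodes_def by (subst sum.Sigma) (auto intro!: sum.cong)
  finally show ?thesis .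
qed

text \<open>Under the degree bounds, \<open>(- 1) ^ n * moment H n\<close> is the
  \<open>n\<close>-th Taylor coefficient of the Pade form at 0.\<close>

definition moment :: "(nat \<Rightarrow> complex poly) \<Rightarrow> nat \<Rightarrow> complex" where
  "moment H n = (\<Sum>i\<in>nodes. coeff (H (fst i) \<circ>\<^sub>p [:1, - 1:]) (snd i) * (node i gchoose n))"

lemma pade_form_has_fps_expansion:
  assumes "\<And>k. k \<le> M \<Longrightarrow> degree (H k) \<le> \<rho> k"
  shows "pade_form M \<omega> H has_fps_expansion Abs_fps (\<lambda>n. (- 1) ^ n * moment H n)"
proof -
  have "eventually (\<lambda>z::complex. z \<in> - {1}) (nhds 0)"
    by (intro eventually_nhds_in_open) auto
  hence "eventually (\<lambda>z. pade_form M \<omega> H z =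
      (\<Sum>i\<in>nodes. coeff (H (fst i) \<circ>\<^sub>p [:1, - 1:]) (snd i) * (1 - z) powr node i)) (nhds 0)"
    by eventually_elim (use pade_form_conv_powr_sum[OF assms] in auto)
  thus ?thesis
    using has_fps_expansion_powr_sum unfolding moment_def
    by (subst has_fps_expansion_cong) auto
qed

text \<open>Replaces the analytic conditions by one linear equation for each moment of order below
  \<sigma>, as many as there are nodes.\<close>

lemma is_pade_system_iff:
  "is_pade_system M \<omega> \<rho> H \<longleftrightarrow>
     (\<forall>k\<le>M. degree (H k) \<le> \<rho> k) \<and> (\<forall>k>M. H k = 0) \<and>
     (\<forall>n<pade_sigma M \<rho> - 1. moment H n = 0) \<and>
     (- 1) ^ (pade_sigma M \<rho> - 1) * moment H (pade_sigma M \<rho> - 1) = 1 / fact (pade_sigma M \<rho> - 1)"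
  (is "_ \<longleftrightarrow> ?D \<and> ?Z \<and> ?L \<and> ?T")
proof (cases ?D)
  case True
  let ?s = "pade_sigma M \<rho> - 1"
  let ?F = "Abs_fps (\<lambda>n. (- 1) ^ n * moment H n)"
  have exp: "pade_form M \<omega> H has_fps_expansion ?F"
    using True by (intro pade_form_has_fps_expansion) auto
  note lim = tendsto_divide_power_iff_fps_nth[OF exp, of ?s "1 / fact ?s"]
  \<comment> \<open>The coefficient of order \<open>?s\<close> is nonzero by the normalisation, so
    \<open>?s\<close> is the subdegree of the expansion and hence the order of the zero.\<close>
  have "zorder (pade_form M \<omega> H) 0 = int ?s" if ?L ?T
  proof -
    have "subdegree ?F = ?s" using that by (intro subdegreeI) auto
    moreover have "fps_nth ?F ?s \<noteq> 0" using that by auto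
    hence "?F \<noteq> 0" by (metis fps_zero_nth)
    ultimately show ?thesis using has_fps_expansion_zorder_0[OF exp] by simp
  qed
  thus ?thesis unfolding is_pade_system_def lim using True by auto
qed (auto simp: is_pade_system_def)

text \<open>The difference of two solutions has vanishing binomial moments below
  \<open>card nodes\<close>, hence vanishing moments for all polynomials of smaller degree, so its
  coefficients are 0.\<close>

lemma is_pade_system_unique:
  assumes "is_pade_system M \<omega> \<rho> H" "is_pade_system M \<omega> \<rho> H'"
  shows "H = H'"
proof
  fix k
  let ?c = "\<lambda>H i. coeff (H (fst i) \<circ>\<^sub>p [:1, - 1:]) (snd i) :: complex"
  have D: "degree (H k) \<le> \<rho> k" "degree (H' k) \<le> \<rho> k" if "k \<le> M" for k
    using assms that by (auto simp: is_pade_system_def)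
  have "moment H n = moment H' n" if "n < pade_sigma M \<rho>" for n
  proof (cases "n = pade_sigma M \<rho> - 1")
    case True
    have "(- 1) ^ n * moment H n = (- 1) ^ n * moment H' n"
      using assms by (simp add: is_pade_system_iff True)
    thus ?thesis by simp
  next
    case False
    with that have "n < pade_sigma M \<rho> - 1" by simp
    thus ?thesis using assms by (simp add: is_pade_system_iff)
  qed
  hence "(\<Sum>i\<in>nodes. (?c H i - ?c H' i) * (node i gchoose n)) = 0" if "n < pade_sigma M \<rho>" for n
    using that by (simp add: moment_def left_diff_distrib sum_subtractf)
  hence eq: "?c H i - ?c H' i = 0" if "i \<in> nodes" for i
    using vanishing_moments_imp_zero[OF finite_nodes inj_on_node, of "\<lambda>i. ?c H i - ?c H' i"]
      gbinomial_moments_imp_moments[where N = "card nodes" and I = nodes and x = node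
        and c = "\<lambda>i. ?c H i - ?c H' i"] that
    unfolding card_nodes by blast
  show "H k = H' k"
  proof (cases "k \<le> M")
    case True
    have "?c H (k, r) = ?c H' (k, r)" if "r \<le> \<rho> k" for r
      using eq[of "(k, r)"] that True by (simp add: nodes_def)
    hence "poly (H k) z = poly (H' k) z" for z
      unfolding poly_pcompose_one_minus[OF D(1)[OF True]] poly_pcompose_one_minus[OF D(2)[OF True]]
      by (intro sum.cong) auto
    thus ?thesis by (simp add: poly_eq_poly_eq_iff[symmetric] fun_eq_iff)
  qed (use assms in \<open>auto simp: is_pade_system_def\<close>)
qed

text \<open>The candidate solution; the value 0 beyond \<open>M\<close> matches the convention in
  \<open>is_pade_system\<close>.\<close>

definition pade_explicit :: "nat \<Rightarrow> complex poly" where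
  "pade_explicit k = (if k \<le> M then \<Sum>r\<le>\<rho> k. smult (pcoef k r) ([:- 1, 1:] ^ r) else 0)"

text \<open>Composition with \<open>1 - x\<close> sends \<open>x - 1\<close> to \<open>- x\<close>,
  hence its \<open>r\<close>-th power to a signed monomial.\<close>

lemma coeff_pade_explicit:
  assumes "(k, r) \<in> nodes"
  shows "coeff (pade_explicit k \<circ>\<^sub>p [:1, - 1:]) r = (- 1) ^ r * pcoef k r"
proof -
  have comp: "[:- 1, 1:] \<circ>\<^sub>p [:1, - 1:] = (monom (- 1) 1 :: complex poly)"
    by (simp add: pcompose_pCons monom_altdef)
  have comp_pow: "([:- 1, 1:] ^ r) \<circ>\<^sub>p [:1, - 1:] = (monom ((- 1) ^ r) r :: complex poly)" for r
    by (induction r) (simp_all add: pcompose_mult comp mult_monom pcompose_1 del: mult_pCons_left)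
  have "pade_explicit k \<circ>\<^sub>p [:1, - 1:] = (\<Sum>r\<le>\<rho> k. smult (pcoef k r) (monom ((- 1) ^ r) r))"
    using assms unfolding pade_explicit_def
    by (simp add: nodes_def pcompose_sum pcompose_smult comp_pow)
  thus ?thesis using assms
    by (simp add: nodes_def coeff_sum if_distrib mult.commute cong: if_cong)
qed

text \<open>With these coefficients the moment of order \<open>n\<close> is, up to sign and
  \<open>1 / fact n\<close>, a divided difference of \<open>falling_poly n\<close> over all nodes,
  that is, its coefficient of degree \<open>?s\<close>: 0 for \<open>n < ?s\<close> and 1 for
  \<open>n = ?s\<close>.\<close>

lemma is_pade_system_explicit: "is_pade_system M \<omega> \<rho> pade_explicit"
proof -
  let ?s = "pade_sigma M \<rho> - 1"
  have mom: "moment pade_explicit n = (- 1) ^ ?s / fact n * coeff (falling_poly n) ?s" if "n \<le> ?s" for n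
  proof -
    have "moment pade_explicit n = (\<Sum>i\<in>nodes. (- 1) ^ ?s / fact n *
        (poly (falling_poly n) (node i) / (\<Prod>j\<in>nodes - {i}. node i - node j)))"
      unfolding moment_def
    proof (rule sum.cong[OF refl], goal_cases)
      case (1 i)
      obtain k r where i: "i = (k, r)" by (cases i)
      with 1 have kr: "k \<le> M" "r \<le> \<rho> k" by (auto simp: nodes_def)
      show ?case using 1
        by (simp add: i coeff_pade_explicit pcoef_conv_node_prod[OF kr] falling_poly(3))
    qed
    also have "\<dots> = (- 1) ^ ?s / fact n * coeff (falling_poly n) (card nodes - 1)"
      unfolding sum_distrib_left[symmetric]
      by (subst divided_difference_poly)
         (use that pade_sigma_pos in \<open>auto simp: inj_on_node card_nodes falling_poly(1)\<close>)
    finally show ?thesis by (simp add: card_nodes)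
  qed
  have "degree (pade_explicit k) \<le> \<rho> k" for k
    unfolding pade_explicit_def
    by (auto intro!: degree_sum_le order.trans[OF degree_smult_le] simp: degree_linear_power)
  moreover have "moment pade_explicit n = 0" if "n < ?s" for n
    using that by (subst mom) (simp_all add: coeff_eq_0 falling_poly(1))
  moreover have "(- 1) ^ ?s * moment pade_explicit ?s = 1 / fact ?s"
    by (subst mom) (simp_all add: falling_poly(2) power_mult_distrib[symmetric])
  moreover have "pade_explicit k = 0" if "k > M" for k
    using that by (simp add: pade_explicit_def)
  ultimately show ?thesis
    unfolding is_pade_system_iff by blast
qed

section \<open>Identification of the Pade approximants\<close>

lemma poly_pade_poly:
  assumes "m \<le> M"
  shows "poly (pade_poly M \<omega> \<rho> m) z = (\<Sum>r\<le>\<rho> m. (z - 1) ^ r * pcoef m r)"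
proof -
  have "(THE H. is_pade_system M \<omega> \<rho> H) = pade_explicit"
    using is_pade_system_explicit is_pade_system_unique by (intro the_equality) auto
  thus ?thesis using assms
    by (simp add: pade_poly_def pade_explicit_def poly_sum algebra_simps)
qed

subsection \<open>The five expressions\<close>

lemma poly_pade_poly_binomial:
  assumes "m \<le> M"
  shows "poly (pade_poly M \<omega> \<rho> m) z =
    1 / fact (\<rho> m) * (\<Sum>r\<le>\<rho> m. (z - 1) ^ r * of_nat (\<rho> m choose r) *
      (\<Prod>k\<in>{..M} - {m}. 1 / pochhammer (\<omega> k - \<omega> m - of_nat r) (\<rho> k + 1)))"
  unfolding poly_pade_poly[OF assms] pcoef_def by (simp add: sum_distrib_left mult_ac)

text \<open>The upper parameter with index \<open>m\<close> is \<open>- of_nat (\<rho> m)\<close>;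
  it ends the series and supplies the binomial coefficient. Each other index pairs an upper with a
  lower parameter, and their ratio shifts the rising factorial by \<open>r\<close>.\<close>

lemma poly_pade_poly_hypergeometric:
  assumes m: "m \<le> M"
  shows "poly (pade_poly M \<omega> \<rho> m) z =
    1 / fact (\<rho> m) * (\<Prod>k\<in>{..M} - {m}. 1 / pochhammer (\<omega> k - \<omega> m) (\<rho> k + 1)) *
    hypergeometric (map (\<lambda>k. \<omega> m - \<omega> k - of_nat (\<rho> k)) [0..<Suc M])
      (map (\<lambda>k. 1 + \<omega> m - \<omega> k) (filter (\<lambda>k. k \<noteq> m) [0..<Suc M])) (1 - z)"
proof -
  let ?as = "map (\<lambda>k. \<omega> m - \<omega> k - of_nat (\<rho> k)) [0..<Suc M]"
  let ?bs = "map (\<lambda>k. 1 + \<omega> m - \<omega> k) (filter (\<lambda>k. k \<noteq> m) [0..<Suc M])"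
  have set: "set [0..<Suc M] = {..M}" "set (filter (\<lambda>k. k \<noteq> m) [0..<Suc M]) = {..M} - {m}"
    by auto
  have num: "(\<Prod>a\<leftarrow>?as. pochhammer a r) =
      pochhammer (- of_nat (\<rho> m)) r * (\<Prod>k\<in>{..M} - {m}. pochhammer (\<omega> m - \<omega> k - of_nat (\<rho> k)) r)" for r
  proof -
    have "(\<Prod>a\<leftarrow>?as. pochhammer a r) = (\<Prod>k\<le>M. pochhammer (\<omega> m - \<omega> k - of_nat (\<rho> k)) r)"
      using prod.distinct_set_conv_list[of "[0..<Suc M]" "\<lambda>k. pochhammer (\<omega> m - \<omega> k - of_nat (\<rho> k)) r"]
      unfolding set by (simp add: o_def)
    also have "\<dots> = pochhammer (\<omega> m - \<omega> m - of_nat (\<rho> m)) r *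
        (\<Prod>k\<in>{..M} - {m}. pochhammer (\<omega> m - \<omega> k - of_nat (\<rho> k)) r)"
      by (rule prod.remove) (use m in auto)
    finally show ?thesis by simp
  qed
  have den: "(\<Prod>b\<leftarrow>?bs. pochhammer b r) = (\<Prod>k\<in>{..M} - {m}. pochhammer (1 + \<omega> m - \<omega> k) r)" for r
    using prod.distinct_set_conv_list[of "filter (\<lambda>k. k \<noteq> m) [0..<Suc M]" "\<lambda>k. pochhammer (1 + \<omega> m - \<omega> k) r"]
    unfolding set by (simp add: o_def)
  \<comment> \<open>The rising factorial from \<open>- of_nat (\<rho> m)\<close> on contains the
    factor 0 as soon as \<open>r > \<rho> m\<close>.\<close>
  have num0: "(\<Prod>a\<leftarrow>?as. pochhammer a r) = 0" if "r > \<rho> m" for r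
    unfolding num using that by (simp add: pochhammer_of_nat_eq_0_lemma)
  have "hypergeometric ?as ?bs (1 - z) =
      (\<Sum>r\<le>\<rho> m. (\<Prod>a\<leftarrow>?as. pochhammer a r) / (\<Prod>b\<leftarrow>?bs. pochhammer b r) * ((1 - z) ^ r / fact r))"
    unfolding hypergeometric_altdef
    by (rule suminf_finite) (simp_all only: finite_atMost atMost_iff not_le num0 div_0 mult_zero_left)
  moreover have "1 / fact (\<rho> m) * (\<Prod>k\<in>{..M} - {m}. 1 / pochhammer (\<omega> k - \<omega> m) (\<rho> k + 1)) *
      ((\<Prod>a\<leftarrow>?as. pochhammer a r) / (\<Prod>b\<leftarrow>?bs. pochhammer b r) * ((1 - z) ^ r / fact r)) =
      (z - 1) ^ r * pcoef m r" if r: "r \<le> \<rho> m" for r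
  proof -
    have ratio: "1 / pochhammer (\<omega> k - \<omega> m) (\<rho> k + 1) *
        (pochhammer (\<omega> m - \<omega> k - of_nat (\<rho> k)) r / pochhammer (1 + \<omega> m - \<omega> k) r) =
        1 / pochhammer (\<omega> k - \<omega> m - of_nat r) (\<rho> k + 1)" if "k \<in> {..M} - {m}" for k
    proof -
      have k: "k \<le> M" "k \<noteq> m" using that by auto
      have e: "1 + \<omega> m - \<omega> k = 1 - (\<omega> k - \<omega> m)" by simp
      have "pochhammer (1 + \<omega> m - \<omega> k) r \<noteq> 0"
        using pochhammer_nonzero[OF k(1) m k(2)] unfolding e pochhammer_one_minus by simp
      moreover have "pochhammer (\<omega> k - \<omega> m - of_nat r) (\<rho> k + 1) \<noteq> 0"
        "pochhammer (\<omega> k - \<omega> m) (\<rho> k + 1) \<noteq> 0"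
        using pochhammer_nonzero[OF k(1) m k(2)] pochhammer_nonzero[OF k(1) m k(2), of 0] by auto
      moreover have "pochhammer (\<omega> k - \<omega> m - of_nat r) (\<rho> k + 1) * pochhammer (\<omega> m - \<omega> k - of_nat (\<rho> k)) r =
          pochhammer (\<omega> k - \<omega> m) (\<rho> k + 1) * pochhammer (1 + \<omega> m - \<omega> k) r"
        using pochhammer_shift_ratio[of "\<omega> k - \<omega> m" r "\<rho> k"] unfolding e by (simp only: minus_diff_eq)
      ultimately show ?thesis by (simp add: field_simps del: pochhammer_Suc)
    qed
    let ?X = "\<Prod>k\<in>{..M} - {m}. 1 / pochhammer (\<omega> k - \<omega> m) (\<rho> k + 1)"
    have "pcoef m r = of_nat (\<rho> m choose r) / fact (\<rho> m) *
        (?X * ((\<Prod>k\<in>{..M} - {m}. pochhammer (\<omega> m - \<omega> k - of_nat (\<rho> k)) r) /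
          (\<Prod>k\<in>{..M} - {m}. pochhammer (1 + \<omega> m - \<omega> k) r)))"
      unfolding pcoef_def prod_dividef[symmetric] prod.distrib[symmetric]
      using ratio by (intro arg_cong2[where f = times] prod.cong refl) simp
    \<comment> \<open>Here \<open>fact r\<close> cancels the factorial of the series, and the sign
      turns \<open>(1 - z) ^ r\<close> into \<open>(z - 1) ^ r\<close>.\<close>
    moreover have "pochhammer (- of_nat (\<rho> m)) r = fact r * ((- 1 :: complex) ^ r * of_nat (\<rho> m choose r))"
      by (simp add: binomial_gbinomial gbinomial_pochhammer)
    moreover have "(z - 1) ^ r = (- 1) ^ r * (1 - z) ^ r"
      by (simp flip: power_mult_distrib)
    ultimately show ?thesis
      unfolding num den by simp
  qed
  ultimately show ?thesis
    unfolding poly_pade_poly[OF m] by (simp only: sum_distrib_left) (auto intro!: sum.cong)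
qed

text \<open>Gamma at positive integers and the binomial coefficients become factorials that cancel
  down to \<open>fact (\<rho> k)\<close>; the remaining Gamma values form the reversed quotient when
  \<open>\<rho> k < r\<close> and the reflected one otherwise.\<close>

lemma pade_coeff_eq:
  assumes "k \<le> M" "m \<le> M" "k \<noteq> m"
  shows "pade_coeff \<omega> \<rho> m k r / fact (\<rho> k) = 1 / pochhammer (\<omega> k - \<omega> m - of_nat r) (\<rho> k + 1)"
proof -
  define W where "W = \<omega> k - \<omega> m"
  have W: "W \<notin> \<int>" using nonint assms by (simp add: W_def)
  show ?thesis
  proof (cases "\<rho> k < r")
    case True
    have "inverse (of_nat (r choose \<rho> k)) = (fact (\<rho> k) * fact (r - \<rho> k) / fact r :: complex)"
      using True by (subst binomial_fact) auto
    moreover have "Gamma (of_nat r - of_nat (\<rho> k) + 1 :: complex) = fact (r - \<rho> k)"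
      using True Gamma_fact[of "r - \<rho> k", where 'a = complex] by (simp add: of_nat_diff add_ac)
    moreover have "Gamma (of_nat r + 1 :: complex) = fact r"
      using Gamma_fact[of r, where 'a = complex] by (simp add: add_ac)
    ultimately have "pade_coeff \<omega> \<rho> m k r = (- 1) ^ (\<rho> k + 1) * (fact (\<rho> k) * fact (r - \<rho> k) / fact r) *
        (fact r / Gamma (of_nat r + 1 - W)) *
        (Gamma (of_nat r - of_nat (\<rho> k) - W) / fact (r - \<rho> k))"
      using True not_sym[OF assms(3)] by (simp only: pade_coeff_def Let_def W_def[symmetric] if_True if_False)
    thus ?thesis
      unfolding W_def[symmetric] pochhammer_conv_Gamma_less[OF W]
      by (cases "even (\<rho> k)") simp_all
  next
    case False
    hence "of_nat (\<rho> k choose r) = (fact (\<rho> k) / (fact r * fact (\<rho> k - r)) :: complex)"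
      by (intro binomial_fact) simp
    moreover have "Gamma (of_nat (\<rho> k) - of_nat r + 1 :: complex) = fact (\<rho> k - r)"
      using False Gamma_fact[of "\<rho> k - r", where 'a = complex] by (simp add: of_nat_diff add_ac)
    moreover have "Gamma (of_nat r + 1 :: complex) = fact r"
      using Gamma_fact[of r, where 'a = complex] by (simp add: add_ac)
    ultimately have "pade_coeff \<omega> \<rho> m k r = (- 1) ^ r * (fact (\<rho> k) / (fact r * fact (\<rho> k - r))) *
        (fact r / Gamma (of_nat r + 1 - W)) *
        (fact (\<rho> k - r) / Gamma (of_nat (\<rho> k) - of_nat r + 1 + W)) *
        (of_real pi / sin (of_real pi * W))"
      using False not_sym[OF assms(3)] by (simp only: pade_coeff_def Let_def W_def[symmetric] if_False)
    thus ?thesis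
      unfolding W_def[symmetric] pochhammer_conv_Gamma_reflected[OF W] by simp
  qed
qed

lemma poly_pade_poly_pade_coeff:
  assumes m: "m \<le> M"
  shows "poly (pade_poly M \<omega> \<rho> m) z =
    1 / (\<Prod>k\<le>M. fact (\<rho> k)) * (\<Sum>r\<le>\<rho> m. (z - 1) ^ r * (\<Prod>k\<le>M. pade_coeff \<omega> \<rho> m k r))"
proof -
  have "(\<Prod>k\<le>M. pade_coeff \<omega> \<rho> m k r) / (\<Prod>k\<le>M. fact (\<rho> k)) = pcoef m r" for r
  proof -
    have "(\<Prod>k\<le>M. pade_coeff \<omega> \<rho> m k r) / (\<Prod>k\<le>M. fact (\<rho> k)) =
        (\<Prod>k\<le>M. pade_coeff \<omega> \<rho> m k r / fact (\<rho> k))"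
      by (simp add: prod_dividef)
    also have "\<dots> = pade_coeff \<omega> \<rho> m m r / fact (\<rho> m) *
        (\<Prod>k\<in>{..M} - {m}. pade_coeff \<omega> \<rho> m k r / fact (\<rho> k))"
      by (rule prod.remove) (use m in auto)
    also have "(\<Prod>k\<in>{..M} - {m}. pade_coeff \<omega> \<rho> m k r / fact (\<rho> k)) =
        (\<Prod>k\<in>{..M} - {m}. 1 / pochhammer (\<omega> k - \<omega> m - of_nat r) (\<rho> k + 1))"
      using m by (intro prod.cong[OF refl] pade_coeff_eq) auto
    finally show ?thesis by (simp add: pade_coeff_def pcoef_def)
  qed
  thus ?thesis
    unfolding poly_pade_poly[OF m] by (simp add: sum_distrib_left divide_simps flip: times_divide_eq_right)
qed

text \<open>The binomial theorem for the last factor yields powers of the reciprocal product, which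
  split over the variables. Each one-variable integral brings a sine factor, cancelled by the
  prefactor, and \<open>fact (\<rho> k)\<close>.\<close>

lemma poly_pade_poly_circle_integral:
  assumes m: "m \<le> M" and ks: "distinct ks" "set ks = {..M} - {m}"
  shows "poly (pade_poly M \<omega> \<rho> m) z =
    (\<Prod>k\<in>{..M} - {m}. 1 / (2 * \<i> * sin (of_real pi * (\<omega> k - \<omega> m)))) / (\<Prod>k\<le>M. fact (\<rho> k)) *
    circle_integral ks
      (\<lambda>t. (\<Prod>k\<in>{..M} - {m}. t k powr (- \<omega> m - 1)) *
        (\<Prod>k\<in>{..M} - {m}. t k powr \<omega> k * (1 + t k) ^ \<rho> k) *
        (1 - (- 1) ^ M * ((1 - z) / (\<Prod>k\<in>{..M} - {m}. t k))) ^ \<rho> m)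
      t0"
proof -
  define K where "K = {..M} - {m}"
  define a where "a r = of_nat (\<rho> m choose r) * (- ((- 1) ^ M * (1 - z))) ^ r" for r
  define g where "g r k t = t powr (- \<omega> m - 1) * (t powr \<omega> k * (1 + t) ^ \<rho> k) * (1 / t) ^ r" for r k and t :: complex
  define s where "s k = 2 * \<i> * sin (of_real pi * (\<omega> k - \<omega> m))" for k
  have ksK: "set ks = K" using ks(2) by (simp add: K_def)
  have K: "finite K" "card K = M" using m by (auto simp: K_def)
  have W: "\<omega> k - \<omega> m \<notin> \<int>" if "k \<in> K" for k
    using that nonint m by (simp add: K_def)
  have s0: "s k \<noteq> 0" if "k \<in> K" for k
    using sin_pi_times_nonzero[OF W[OF that]] by (simp add: s_def)
  have int: "(g r k has_contour_integral
      s k * ((- 1) ^ r * fact (\<rho> k) / pochhammer (\<omega> k - \<omega> m - of_nat r) (\<rho> k + 1)))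
      (part_circlepath 0 1 (- pi) pi)" if "k \<in> K" for r k
    unfolding g_def s_def by (rule has_contour_integral_powr_circle[OF W[OF that]])
  have integrable: "g r k contour_integrable_on part_circlepath 0 1 (- pi) pi" if "k \<in> K" for r k
    using int[OF that] unfolding contour_integrable_on_def by blast
  have "(\<Prod>k\<in>K. t k powr (- \<omega> m - 1)) * (\<Prod>k\<in>K. t k powr \<omega> k * (1 + t k) ^ \<rho> k) *
      (1 - (- 1) ^ M * ((1 - z) / (\<Prod>k\<in>K. t k))) ^ \<rho> m =
      (\<Sum>r\<le>\<rho> m. a r * (\<Prod>k\<in>K. g r k (t k)))" for t
  proof -
    have "(1 - (- 1) ^ M * ((1 - z) / (\<Prod>k\<in>K. t k))) ^ \<rho> m =
        (- ((- 1) ^ M * (1 - z)) * (\<Prod>k\<in>K. 1 / t k) + 1) ^ \<rho> m"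
      by (simp add: prod_dividef)
    also have "\<dots> = (\<Sum>r\<le>\<rho> m. a r * (\<Prod>k\<in>K. (1 / t k) ^ r))"
      unfolding binomial_ring a_def power_mult_distrib prod_power_distrib by (simp add: mult_ac)
    finally show ?thesis
      by (simp add: g_def prod.distrib sum_distrib_left mult_ac)
  qed
  hence "circle_integral ks
      (\<lambda>t. (\<Prod>k\<in>K. t k powr (- \<omega> m - 1)) * (\<Prod>k\<in>K. t k powr \<omega> k * (1 + t k) ^ \<rho> k) *
        (1 - (- 1) ^ M * ((1 - z) / (\<Prod>k\<in>K. t k))) ^ \<rho> m) t0 =
      (\<Sum>r\<le>\<rho> m. a r * (\<Prod>k\<in>K. contour_integral (part_circlepath 0 1 (- pi) pi) (g r k)))"
    using circle_integral_sum_prod[of "{..\<rho> m}" K ks g a t0] ks(1) ksK K(1) integrable by simp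
  also have "\<dots> = (\<Sum>r\<le>\<rho> m. a r * ((\<Prod>k\<in>K. s k) * (((- 1) ^ r) ^ M * (\<Prod>k\<in>K. fact (\<rho> k)) *
      (\<Prod>k\<in>K. 1 / pochhammer (\<omega> k - \<omega> m - of_nat r) (\<rho> k + 1)))))"
  proof (intro sum.cong refl arg_cong2[where f = times])
    fix r
    have "(\<Prod>k\<in>K. contour_integral (part_circlepath 0 1 (- pi) pi) (g r k)) =
        (\<Prod>k\<in>K. s k * ((- 1) ^ r * fact (\<rho> k) * (1 / pochhammer (\<omega> k - \<omega> m - of_nat r) (\<rho> k + 1))))"
      using int by (intro prod.cong[OF refl]) (simp add: contour_integral_unique)
    also have "\<dots> = (\<Prod>k\<in>K. s k) * (((- 1) ^ r) ^ M * (\<Prod>k\<in>K. fact (\<rho> k)) *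
      (\<Prod>k\<in>K. 1 / pochhammer (\<omega> k - \<omega> m - of_nat r) (\<rho> k + 1)))"
      by (simp only: prod.distrib prod_constant K(2))
    finally show "(\<Prod>k\<in>K. contour_integral (part_circlepath 0 1 (- pi) pi) (g r k)) = \<dots>" .
  qed
  also have "\<dots> = (\<Prod>k\<in>K. s k) * (\<Prod>k\<le>M. fact (\<rho> k)) * (\<Sum>r\<le>\<rho> m. (z - 1) ^ r * pcoef m r)"
    unfolding sum_distrib_left
  proof (rule sum.cong[OF refl])
    fix r
    have fact: "(\<Prod>k\<le>M. fact (\<rho> k)) = fact (\<rho> m) * (\<Prod>k\<in>K. fact (\<rho> k) :: complex)"
      unfolding K_def by (rule prod.remove) (use m in auto)
    \<comment> \<open>Each of the \<open>M\<close> integrals contributes \<open>(- 1) ^ r\<close>;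
      together they cancel the \<open>(- 1) ^ M\<close> of the integrand, raised to the power
      \<open>r\<close>.\<close>
    have "((- 1 :: complex) ^ r) ^ M = ((- 1) ^ M) ^ r"
      by (metis power_mult mult.commute)
    hence "(- ((- 1) ^ M * (1 - z))) ^ r * ((- 1) ^ r) ^ M = (((- 1) ^ M * (- 1) ^ M) * (z - 1)) ^ r"
      by (simp only: power_mult_distrib[symmetric]) (simp add: algebra_simps)
    also have "(- 1 :: complex) ^ M * (- 1) ^ M = 1"
      by (simp flip: power_mult_distrib)
    finally have sgn: "(- ((- 1) ^ M * (1 - z))) ^ r * ((- 1) ^ r) ^ M = (z - 1) ^ r"
      by simp
    show "a r * ((\<Prod>k\<in>K. s k) * (((- 1) ^ r) ^ M * (\<Prod>k\<in>K. fact (\<rho> k)) *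
        (\<Prod>k\<in>K. 1 / pochhammer (\<omega> k - \<omega> m - of_nat r) (\<rho> k + 1)))) =
        (\<Prod>k\<in>K. s k) * (\<Prod>k\<le>M. fact (\<rho> k)) * ((z - 1) ^ r * pcoef m r)"
      unfolding fact pcoef_def K_def[symmetric] sgn[symmetric] a_def by (simp add: mult_ac)
  qed
  finally show ?thesis
    unfolding poly_pade_poly[OF m] K_def[symmetric] s_def[symmetric] prod_dividef
    using s0 K by simp
qed

text \<open>The denominator is the product over all nodes, which are distinct, so the poles are at
  most simple. The winding number is 1 at the nodes of block \<open>m\<close> and 0 at the others,
  and the residues in that block are the summands of the approximant up to sign.\<close>

lemma poly_pade_poly_contour_integral:
  assumes m: "m \<le> M" and z: "z \<noteq> 1" and \<gamma>: "simple_positive_contour \<gamma>"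
    and ins: "\<And>r. r \<le> \<rho> m \<Longrightarrow> \<omega> m + of_nat r \<in> inside (path_image \<gamma>)"
    and out: "\<And>k r. k \<le> M \<Longrightarrow> k \<noteq> m \<Longrightarrow> r \<le> \<rho> k \<Longrightarrow> \<omega> k + of_nat r \<in> outside (path_image \<gamma>)"
  shows "poly (pade_poly M \<omega> \<rho> m) z =
    (- 1) ^ (pade_sigma M \<rho> - 1) / (2 * of_real pi * \<i>) *
    contour_integral \<gamma> (\<lambda>\<xi>. (1 - z) powr (\<xi> - \<omega> m) *
      (\<Prod>k\<le>M. 1 / falling_factorial (\<xi> - \<omega> k) (\<rho> k + 1)))"
proof -
  let ?s = "pade_sigma M \<rho> - 1"
  define f where "f \<xi> = (1 - z) powr (\<xi> - \<omega> m) / (\<Prod>i\<in>nodes. \<xi> - node i)" for \<xi>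
  define D where "D i = (\<Prod>j\<in>nodes - {i}. node i - node j)" for i
  have \<gamma>': "valid_path \<gamma>" "pathfinish \<gamma> = pathstart \<gamma>"
    "\<And>w. w \<in> inside (path_image \<gamma>) \<Longrightarrow> winding_number \<gamma> w = 1"
    using \<gamma> by (auto simp: simple_positive_contour_def)
  have wind: "winding_number \<gamma> (node i) = (if fst i = m then 1 else 0)" if "i \<in> nodes" for i
    using that ins[of "snd i"] out[of "fst i" "snd i"] \<gamma>' winding_number_zero_in_outside[OF valid_path_imp_path]
    by (auto simp: nodes_def node_def)
  have off: "node i \<notin> path_image \<gamma>" if "i \<in> nodes" for i
  proof (cases "fst i = m")
    case True
    hence "node i \<in> inside (path_image \<gamma>)"
      using ins[of "snd i"] that by (auto simp: nodes_def node_def)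
    thus ?thesis using inside_no_overlap by blast
  next
    case False
    hence "node i \<in> outside (path_image \<gamma>)"
      using out[of "fst i" "snd i"] that by (auto simp: nodes_def node_def)
    thus ?thesis using outside_no_overlap by blast
  qed
  have f_eq: "(\<lambda>\<xi>. (1 - z) powr (\<xi> - \<omega> m) * (\<Prod>k\<le>M. 1 / falling_factorial (\<xi> - \<omega> k) (\<rho> k + 1))) = f"
  proof
    fix \<xi>
    have "(\<Prod>k\<le>M. falling_factorial (\<xi> - \<omega> k) (\<rho> k + 1)) = (\<Prod>k\<le>M. \<Prod>r\<le>\<rho> k. \<xi> - node (k, r))"
      by (simp add: falling_factorial_def node_def lessThan_Suc_atMost diff_diff_eq del: prod.lessThan_Suc)
    also have "\<dots> = (\<Prod>i\<in>nodes. \<xi> - node i)"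
      unfolding nodes_def by (subst prod.Sigma) auto
    finally show "(1 - z) powr (\<xi> - \<omega> m) * (\<Prod>k\<le>M. 1 / falling_factorial (\<xi> - \<omega> k) (\<rho> k + 1)) = f \<xi>"
      by (simp add: f_def prod_dividef)
  qed
  have res: "residue f (node i) = (1 - z) powr (node i - \<omega> m) / D i" if i: "i \<in> nodes" for i
  proof -
    \<comment> \<open>With the factor of node \<open>i\<close> removed, \<open>h\<close> is
      holomorphic on the complement \<open>U\<close> of the other nodes, and the residue is its
      value at node \<open>i\<close>.\<close>
    define h where "h \<xi> = (1 - z) powr (\<xi> - \<omega> m) / (\<Prod>j\<in>nodes - {i}. \<xi> - node j)" for \<xi>
    define U where "U = - (node ` (nodes - {i}))"
    have "f = (\<lambda>\<xi>. h \<xi> / (\<xi> - node i))"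
      using i by (auto simp: f_def h_def prod.remove[OF finite_nodes i])
    moreover have "open U" unfolding U_def by (intro open_Compl finite_imp_closed) simp
    moreover have "node i \<in> U" using i inj_on_node by (auto simp: U_def inj_on_def)
    moreover have "h holomorphic_on U"
      unfolding h_def U_def using z by (auto intro!: holomorphic_intros)
    ultimately have "residue f (node i) = h (node i)"
      using residue_simple by blast
    thus ?thesis by (simp add: h_def D_def)
  qed
  have "f holomorphic_on UNIV - node ` nodes"
    unfolding f_def using z by (auto intro!: holomorphic_intros)
  hence "contour_integral \<gamma> f =
      2 * pi * \<i> * (\<Sum>p\<in>node ` nodes. winding_number \<gamma> p * residue f p)"
    using \<gamma>' off by (intro Residue_theorem[of UNIV]) auto
  also have "(\<Sum>p\<in>node ` nodes. winding_number \<gamma> p * residue f p) =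
      (\<Sum>i\<in>nodes. (if fst i = m then 1 else 0) * ((1 - z) powr (node i - \<omega> m) / D i))"
    by (subst sum.reindex[OF inj_on_node]) (auto simp: wind res)
  also have "\<dots> = (\<Sum>k\<le>M. \<Sum>r\<le>\<rho> k. (if k = m then 1 else 0) * ((1 - z) powr (node (k, r) - \<omega> m) / D (k, r)))"
    unfolding nodes_def by (subst sum.Sigma) (auto intro!: sum.cong)
  also have "\<dots> = (\<Sum>k\<le>M. if k = m then \<Sum>r\<le>\<rho> m. (1 - z) powr (node (m, r) - \<omega> m) / D (m, r) else 0)"
    by (intro sum.cong) auto
  also have "\<dots> = (\<Sum>r\<le>\<rho> m. (1 - z) powr (node (m, r) - \<omega> m) / D (m, r))"
    using m by simp
  also have "\<dots> = (\<Sum>r\<le>\<rho> m. (- 1) ^ ?s * ((z - 1) ^ r * pcoef m r))"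
  proof (rule sum.cong[OF refl])
    fix r assume "r \<in> {..\<rho> m}"
    hence "(- 1) ^ r * pcoef m r = (- 1) ^ ?s / D (m, r)"
      unfolding D_def using m by (intro pcoef_conv_node_prod) auto
    hence "1 / D (m, r) = (- 1) ^ ?s * ((- 1) ^ r * pcoef m r)"
      by (simp flip: power_mult_distrib)
    \<comment> \<open>At this node the exponent is the natural number \<open>r\<close>, so the
      principal power is an ordinary one.\<close>
    moreover have "(1 - z) powr (node (m, r) - \<omega> m) = (1 - z) ^ r"
      using z by (simp add: node_def powr_nat')
    moreover have "(z - 1) ^ r = (- 1) ^ r * (1 - z) ^ r"
      by (simp flip: power_mult_distrib)
    moreover have "(1 - z) powr (node (m, r) - \<omega> m) / D (m, r) = (1 - z) powr (node (m, r) - \<omega> m) * (1 / D (m, r))"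
      by simp
    ultimately show "(1 - z) powr (node (m, r) - \<omega> m) / D (m, r) = (- 1) ^ ?s * ((z - 1) ^ r * pcoef m r)"
      by (simp only: mult_ac)
  qed
  also have "\<dots> = (- 1) ^ ?s * poly (pade_poly M \<omega> \<rho> m) z"
    by (simp add: poly_pade_poly[OF m] sum_distrib_left)
  finally have int: "contour_integral \<gamma> f = (2 * of_real pi * \<i>) * ((- 1) ^ ?s * poly (pade_poly M \<omega> \<rho> m) z)"
    by simp
  have cancel: "a / c * (c * (a * p)) = p" if "c \<noteq> 0" "a * a = 1" for a c p :: complex
    using that by (simp flip: mult.assoc)
  show ?thesis
    unfolding f_eq int by (rule cancel[symmetric]) (simp_all flip: power_mult_distrib)
qed

end

theorem theorem5:
  fixes M m :: nat and \<omega> :: "nat \<Rightarrow> complex" and \<rho> :: "nat \<Rightarrow> nat"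
  assumes "inj_on \<omega> {..M}"
    and "\<And>i j. i \<le> M \<Longrightarrow> j \<le> M \<Longrightarrow> i \<noteq> j \<Longrightarrow> \<omega> i - \<omega> j \<notin> \<int>"
    and "m \<le> M"
  shows
    "(\<forall>z \<gamma>. z \<notin> complex_of_real ` {1..} \<and> simple_positive_contour \<gamma> \<and>
        (\<forall>r\<le>\<rho> m. \<omega> m + of_nat r \<in> inside (path_image \<gamma>)) \<and>
        (\<forall>k\<le>M. k \<noteq> m \<longrightarrow> (\<forall>r\<le>\<rho> k. \<omega> k + of_nat r \<in> outside (path_image \<gamma>))) \<longrightarrow>
        poly (pade_poly M \<omega> \<rho> m) z =
          (- 1) ^ (pade_sigma M \<rho> - 1) / (2 * of_real pi * \<i>) *
          contour_integral \<gamma> (\<lambda>\<xi>. (1 - z) powr (\<xi> - \<omega> m) *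
            (\<Prod>k\<le>M. 1 / falling_factorial (\<xi> - \<omega> k) (\<rho> k + 1))))
     \<and> (\<forall>z. poly (pade_poly M \<omega> \<rho> m) z =
          1 / fact (\<rho> m) * (\<Sum>r\<le>\<rho> m. (z - 1) ^ r * of_nat (\<rho> m choose r) *
            (\<Prod>k\<in>{..M} - {m}. 1 / pochhammer (\<omega> k - \<omega> m - of_nat r) (\<rho> k + 1))))
     \<and> (M \<ge> 1 \<longrightarrow> (\<forall>z ks. distinct ks \<and> set ks = {..M} - {m} \<longrightarrow>
        poly (pade_poly M \<omega> \<rho> m) z =
          (\<Prod>k\<in>{..M} - {m}. 1 / (2 * \<i> * sin (of_real pi * (\<omega> k - \<omega> m)))) /
          (\<Prod>k\<le>M. fact (\<rho> k)) *
          circle_integral ks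
            (\<lambda>t. (\<Prod>k\<in>{..M} - {m}. t k powr (- \<omega> m - 1)) *
              (\<Prod>k\<in>{..M} - {m}. t k powr \<omega> k * (1 + t k) ^ \<rho> k) *
              (1 - (- 1) ^ M * ((1 - z) / (\<Prod>k\<in>{..M} - {m}. t k))) ^ \<rho> m)
            (\<lambda>_. 1)))
     \<and> (\<forall>z. poly (pade_poly M \<omega> \<rho> m) z =
          1 / fact (\<rho> m) *
          (\<Prod>k\<in>{..M} - {m}. 1 / pochhammer (\<omega> k - \<omega> m) (\<rho> k + 1)) *
          hypergeometric
            (map (\<lambda>k. \<omega> m - \<omega> k - of_nat (\<rho> k)) [0..<Suc M])
            (map (\<lambda>k. 1 + \<omega> m - \<omega> k) (filter (\<lambda>k. k \<noteq> m) [0..<Suc M]))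
            (1 - z))
     \<and> (\<forall>z. poly (pade_poly M \<omega> \<rho> m) z =
          1 / (\<Prod>k\<le>M. fact (\<rho> k)) *
          (\<Sum>r\<le>\<rho> m. (z - 1) ^ r * (\<Prod>k\<le>M. pade_coeff \<omega> \<rho> m k r)))"
proof -
  interpret pade_data M \<omega> \<rho>
    using assms(2) by unfold_locales
  \<comment> \<open>The excluded ray starts at 1, so off the ray the base \<open>1 - z\<close> is
    nonzero.\<close>
  have "z \<noteq> 1" if "z \<notin> complex_of_real ` {1..}" for z
    using that by force
  thus ?thesis
    using poly_pade_poly_contour_integral[OF assms(3)] poly_pade_poly_binomial[OF assms(3)]
      poly_pade_poly_circle_integral[OF assms(3)] poly_pade_poly_hypergeometric[OF assms(3)]
      poly_pade_poly_pade_coeff[OF assms(3)]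
    by (intro conjI allI impI) blast+
qed

end
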